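(* Let $\mathbb{K}$ be a commutative field, $\mathcal{A}$ a generic arrangement of $6$ lines in $\mathbb{K}^2$, $\mathcal{Q}_4(\mathcal{B}(6,2,\mathcal{A}))$ the set of quadral points of $\mathcal{B}(6,2,\mathcal{A})$ and $m_4(\mathcal{A})$ its cardinality. There is one and only one partition $\mathcal{V}_\nu$ of the vertex set of the graph $\phi(K_6)$ (where $\nu$ denotes its type) such that $\mathcal{Q}_4(\mathcal{B}(6,2,\mathcal{A}))$ is exactly the set of the intersections $\bigcap_{L\in\mathbb{T}}D_L$, with $\mathbb{T}$ ranging over the $4$-sets corresponding to the edges of $\phi(K_6)[\mathcal{V}_\nu]$. In particular $m_4(\mathcal{A})=2m(\nu)$.
   Context: A generic arrangement of $6$ lines in $\mathbb{K}^2$ is a central arrangement of $6$ pairwise distinct lines $H_1,\dots,H_6$ through the origin, $H_i=\ker\alpha_i$. Its translates $\{H_1^{x_1},\dots,H_6^{x_6}\}$, with $H_i^{x_i}$ parallel to $H_i$ (up to rescaling of $x_i$, $H_i^{x_i}=\{v:\alpha_i(v)=x_i\}$), are parametrized by $x\in\mathbb{K}^6$. For $L\subset\{1,\dots,6\}$ with $|L|=3$, $D_L\subset\mathbb{K}^6$ is the hyperplane of translates whose three lines indexed by $L$ have a common point; $\mathcal{B}(6,2,\mathcal{A})$ is the arrangement of all $D_L$. For $|S|\ge3$, $D_S=\bigcap_{L\subset S,|L|=3}D_L$. An intersection $\bigcap_{i=1}^rD_{L_i}$, $|L_i|=3$, is simple if $\bigcap_{i\in I}D_{L_i}\neq D_S$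 for all $I\subset[r]$, $|I|\ge2$, and all $S$ with $|S|>3$; $r$ is its multiplicity and its codimension is its rank. A quadral point is a simple intersection of rank $3$ and multiplicity $4$. Correspondence with permutations: the permutation $(p_1p_4)(p_2p_5)(p_3p_6)\in S_6$, with $\{p_1,\dots,p_6\}=\{1,\dots,6\}$, corresponds to the two $4$-sets $\mathbb{T}=\{\{p_1,p_2,p_3\},\{p_1,p_5,p_6\},\{p_2,p_4,p_6\},\{p_3,p_4,p_5\}\}$ and $\mathbb{T}'=\{\{1,\dots,6\}\setminus L: L\in\mathbb{T}\}$. Graph: $\phi$ is the outer automorphism of $S_6$ defined by $\phi((12))=(15)(26)(34)$, $\phi((23))=(12)(35)(46)$, $\phi((34))=(15)(24)(36)$, $\phi((45))=(14)(26)(35)$, $\phi((56))=(15)(23)(46)$. $\phi(K_6)$ is the complete graph on vertices $\phi(1),\dots,\phi(6)$ in which the edge joining $\phi(i)$ and $\phi(j)$ is identified with the permutation $\phi((ij))$ (a product of three disjoint transpositions). A partition of the vertex set has type $\nu=i_1^{n_1}\cdots i_l^{n_l}$ if it has exactly $n_j$ blocks of size $i_j$ for each $j$; such a partition is written $\mathcal{V}_\nu$, and $\phi(K_6)[\mathcal{V}_\nu]$ is the subgraph whose connected components are the complete graphs on the blocks. Its number of edges is $m(\nu)=\sum_jn_j\binom{i_j}{2}$. *)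

theory Defs
  imports "HOL-Analysis.Analysis" "HOL-Combinatorics.Perm" "HOL-Library.Disjoint_Sets"
    "HOL-Library.Multiset"
begin

unbundle permutation_syntax

text \<open>
  The index set \<open>{1,\<dots>,6}\<close> is the type \<open>6\<close>, in which the numerals \<open>1\<close> to \<open>6\<close> are the six
  distinct elements (\<open>6 = 0\<close>); thus \<open>\<bbbK>\<^sup>6\<close> is \<open>'a ^ 6\<close> and \<open>S\<^sub>6\<close> is \<open>6 perm\<close>.
\<close>

lemma UNIV_6: "(UNIV :: 6 set) = {1, 2, 3, 4, 5, 6}"
proof -
  have "card {1, 2, 3, 4, 5, 6 :: 6} = CARD(6)" by simp
  then show ?thesis by (metis card_subset_eq finite top_greatest)
qed


subsection \<open>Generic arrangements and their translates\<close>

text \<open>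
  The arrangement is given by the linear forms \<open>\<alpha> i\<close> with \<open>H\<^sub>i = ker (\<alpha> i)\<close>; a linear form is nonzero
  precisely when its kernel is a line.
\<close>

definition generic_arrangement :: "(6 \<Rightarrow> 'a::field ^ 2 \<Rightarrow> 'a) \<Rightarrow> bool" where
  "generic_arrangement \<alpha> \<longleftrightarrow>
     (\<forall>i. Vector_Spaces.linear (*s) (*) (\<alpha> i) \<and> (\<exists>v. \<alpha> i v \<noteq> 0)) \<and>
     inj (\<lambda>i. {v. \<alpha> i v = 0})"

definition translate :: "(6 \<Rightarrow> 'a::field ^ 2 \<Rightarrow> 'a) \<Rightarrow> 6 \<Rightarrow> 'a \<Rightarrow> ('a ^ 2) set" where
  "translate \<alpha> i c = {v. \<alpha> i v = c}"

text \<open>\<open>D_triple \<alpha> L\<close> is \<open>D\<^sub>L\<close>, meaningful for \<open>card L = 3\<close>; \<open>D_set \<alpha> S\<close> is \<open>D\<^sub>S\<close>, for \<open>card S \<ge> 3\<close>.\<close>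

definition D_triple :: "(6 \<Rightarrow> 'a::field ^ 2 \<Rightarrow> 'a) \<Rightarrow> 6 set \<Rightarrow> ('a ^ 6) set" where
  "D_triple \<alpha> L = {x. (\<Inter>i\<in>L. translate \<alpha> i (x $ i)) \<noteq> {}}"

definition D_set :: "(6 \<Rightarrow> 'a::field ^ 2 \<Rightarrow> 'a) \<Rightarrow> 6 set \<Rightarrow> ('a ^ 6) set" where
  "D_set \<alpha> S = (\<Inter>L\<in>{L. L \<subseteq> S \<and> card L = 3}. D_triple \<alpha> L)"


subsection \<open>Simple intersections and quadral points\<close>

text \<open>
  The intersection \<open>\<Inter>\<^sub>i D\<^bsub>L\<^sub>i\<^esub>\<close> of \<open>r\<close> hyperplanes is represented by the set \<open>\<L> = {L\<^sub>1,\<dots>,L\<^sub>r}\<close>, so the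
  \<open>L\<^sub>i\<close> are pairwise distinct and the multiplicity is \<open>card \<L>\<close>.
\<close>

definition simple_intersection :: "(6 \<Rightarrow> 'a::field ^ 2 \<Rightarrow> 'a) \<Rightarrow> 6 set set \<Rightarrow> bool" where
  "simple_intersection \<alpha> \<L> \<longleftrightarrow>
     (\<forall>L\<in>\<L>. card L = 3) \<and>
     (\<forall>I S. I \<subseteq> \<L> \<and> card I \<ge> 2 \<and> card S > 3 \<longrightarrow> (\<Inter>L\<in>I. D_triple \<alpha> L) \<noteq> D_set \<alpha> S)"

definition codim :: "('a::field ^ 6) set \<Rightarrow> nat" where
  "codim X = 6 - vec.dim X"

definition quadral_points :: "(6 \<Rightarrow> 'a::field ^ 2 \<Rightarrow> 'a) \<Rightarrow> ('a ^ 6) set set" where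
  "quadral_points \<alpha> =
     {\<Inter>L\<in>\<L>. D_triple \<alpha> L | \<L>.
        simple_intersection \<alpha> \<L> \<and> card \<L> = 4 \<and> codim (\<Inter>L\<in>\<L>. D_triple \<alpha> L) = 3}"


subsection \<open>Permutations and the corresponding 4-sets of triples\<close>

definition corresponding :: "6 perm \<Rightarrow> 6 set set \<Rightarrow> bool" where
  "corresponding \<sigma> T \<longleftrightarrow>
     (\<exists>p1 p2 p3 p4 p5 p6. {p1, p2, p3, p4, p5, p6} = UNIV \<and>
        \<sigma> = \<langle>p1 \<leftrightarrow> p4\<rangle> * \<langle>p2 \<leftrightarrow> p5\<rangle> * \<langle>p3 \<leftrightarrow> p6\<rangle> \<and>
        (let T\<^sub>0 = {{p1, p2, p3}, {p1, p5, p6}, {p2, p4, p6}, {p3, p4, p5}}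
         in T = T\<^sub>0 \<or> T = (\<lambda>L. - L) ` T\<^sub>0))"


subsection \<open>The automorphism \<open>\<phi>\<close> of \<open>S\<^sub>6\<close>\<close>

definition is_outer_phi :: "(6 perm \<Rightarrow> 6 perm) \<Rightarrow> bool" where
  "is_outer_phi f \<longleftrightarrow> bij f \<and> (\<forall>\<sigma> \<tau>. f (\<sigma> * \<tau>) = f \<sigma> * f \<tau>) \<and>
   f \<langle>1 \<leftrightarrow> 2\<rangle> = \<langle>1 \<leftrightarrow> 5\<rangle> * \<langle>2 \<leftrightarrow> 6\<rangle> * \<langle>3 \<leftrightarrow> 4\<rangle> \<and>
   f \<langle>2 \<leftrightarrow> 3\<rangle> = \<langle>1 \<leftrightarrow> 2\<rangle> * \<langle>3 \<leftrightarrow> 5\<rangle> * \<langle>4 \<leftrightarrow> 6\<rangle> \<and>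
   f \<langle>3 \<leftrightarrow> 4\<rangle> = \<langle>1 \<leftrightarrow> 5\<rangle> * \<langle>2 \<leftrightarrow> 4\<rangle> * \<langle>3 \<leftrightarrow> 6\<rangle> \<and>
   f \<langle>4 \<leftrightarrow> 5\<rangle> = \<langle>1 \<leftrightarrow> 4\<rangle> * \<langle>2 \<leftrightarrow> 6\<rangle> * \<langle>3 \<leftrightarrow> 5\<rangle> \<and>
   f \<langle>5 \<leftrightarrow> 6\<rangle> = \<langle>1 \<leftrightarrow> 5\<rangle> * \<langle>2 \<leftrightarrow> 3\<rangle> * \<langle>4 \<leftrightarrow> 6\<rangle>"

definition outer_phi :: "6 perm \<Rightarrow> 6 perm" where
  "outer_phi = (THE f. is_outer_phi f)"


subsection \<open>Partitions of the vertex set of \<open>\<phi>(K\<^sub>6)\<close>\<close>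

text \<open>
  The vertex \<open>\<phi>(i)\<close> is represented by its label \<open>i\<close>. So a partition of the vertex set is a partition
  \<open>V\<close> of \<open>UNIV :: 6 set\<close>, and the edge joining \<open>\<phi>(i)\<close> and \<open>\<phi>(j)\<close> is \<open>{i, j}\<close>, which is identified
  with the permutation \<open>\<phi>((i j))\<close>.
\<close>

definition block_edges :: "6 set set \<Rightarrow> 6 set set" where
  "block_edges V = {{i, j} | i j. i \<noteq> j \<and> (\<exists>B\<in>V. i \<in> B \<and> j \<in> B)}"

definition block_edge_perms :: "6 set set \<Rightarrow> 6 perm set" where
  "block_edge_perms V = {outer_phi \<langle>i \<leftrightarrow> j\<rangle> | i j. {i, j} \<in> block_edges V}"

text \<open>
  The type \<open>i\<^sub>1\<^bsup>n\<^sub>1\<^esup> \<cdots> i\<^sub>l\<^bsup>n\<^sub>l\<^esup>\<close> is the multiset in which each block size \<open>i\<^sub>j\<close> occurs \<open>n\<^sub>j\<close> times.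
\<close>

definition partition_type :: "6 set set \<Rightarrow> nat multiset" where
  "partition_type V = image_mset card (mset_set V)"

definition num_edges :: "nat multiset \<Rightarrow> nat" where
  "num_edges \<nu> = (\<Sum>i\<in>set_mset \<nu>. count \<nu> i * (i choose 2))"

definition edge_intersections ::
    "(6 \<Rightarrow> 'a::field ^ 2 \<Rightarrow> 'a) \<Rightarrow> 6 set set \<Rightarrow> ('a ^ 6) set set" where
  "edge_intersections \<alpha> V =
     {\<Inter>L\<in>T. D_triple \<alpha> L | T. \<exists>\<sigma>\<in>block_edge_perms V. corresponding \<sigma> T}"


subsection \<open>Existence and uniqueness of \<open>\<phi>\<close>\<close>

text \<open>
  The definite description defining \<open>outer_phi\<close> denotes: adjacent transpositions generate \<open>S\<^sub>6\<close>, and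
  the automorphism exists because conjugation by \<open>\<sigma>\<close> permutes the 15 permutations
  \<open>phi_inv a b = \<phi>\<^sup>-\<^sup>1((a b))\<close> in the way \<open>\<phi>(\<sigma>)\<close> permutes the pairs \<open>{a, b}\<close>. The map \<open>pair_of\<close>
  recovers \<open>{a, b}\<close> from \<open>phi_inv a b\<close>.
\<close>

lemma all_6: "(\<forall>k::6. P k) \<longleftrightarrow> P 1 \<and> P 2 \<and> P 3 \<and> P 4 \<and> P 5 \<and> P 6"
  by (metis (full_types) UNIV_6 UNIV_I empty_iff insert_iff)

lemma perm6_induct:
  fixes \<sigma> :: "6 perm"
  assumes one: "P 1" and mult: "\<And>\<sigma> \<tau>. P \<sigma> \<Longrightarrow> P \<tau> \<Longrightarrow> P (\<sigma> * \<tau>)"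
    and adj: "P \<langle>1 \<leftrightarrow> 2\<rangle>" "P \<langle>2 \<leftrightarrow> 3\<rangle>" "P \<langle>3 \<leftrightarrow> 4\<rangle>" "P \<langle>4 \<leftrightarrow> 5\<rangle>" "P \<langle>5 \<leftrightarrow> 6\<rangle>"
  shows "P \<sigma>"
proof -
  have conj: "\<langle>a \<leftrightarrow> c\<rangle> = \<langle>a \<leftrightarrow> b\<rangle> * \<langle>b \<leftrightarrow> c\<rangle> * \<langle>a \<leftrightarrow> b\<rangle>"
    if "a \<noteq> c" "b \<noteq> c" for a b c :: 6
    using that by (simp add: perm_eq_iff apply_times swap.rep_eq flip: transpose_comp_triple[of a c b])
  have step: "P \<langle>a \<leftrightarrow> c\<rangle>" if "P \<langle>a \<leftrightarrow> b\<rangle>" "P \<langle>b \<leftrightarrow> c\<rangle>" for a b c :: 6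
  proof (cases "a = c \<or> b = c")
    case True
    then show ?thesis using that one swap_1 by metis
  next
    case False
    then show ?thesis using that mult
      by (subst conj[of a c b]) auto
  qed
  have 3: "P \<langle>1 \<leftrightarrow> 3\<rangle>" by (rule step[OF adj(1,2)])
  have 4: "P \<langle>1 \<leftrightarrow> 4\<rangle>" by (rule step[OF 3 adj(3)])
  have 5: "P \<langle>1 \<leftrightarrow> 5\<rangle>" by (rule step[OF 4 adj(4)])
  have 6: "P \<langle>1 \<leftrightarrow> 6\<rangle>" by (rule step[OF 5 adj(5)])
  have "P \<langle>1 \<leftrightarrow> 1\<rangle>" using one by (simp only: swap_1)
  then have up: "P \<langle>1 \<leftrightarrow> b\<rangle>" for b
    using all_6[of "\<lambda>b. P \<langle>1 \<leftrightarrow> b\<rangle>"] adj(1) 3 4 5 6 by blast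
  have swap: "P \<langle>a \<leftrightarrow> b\<rangle>" for a b
    by (rule step[OF _ up]) (subst swap_sym, rule up)
  show ?thesis
  proof (induction "card (affected \<sigma>)" arbitrary: \<sigma> rule: less_induct)
    case less
    show ?case
    proof (cases "\<sigma> = 1")
      case False
      then obtain a where a: "\<sigma> \<langle>$\<rangle> a \<noteq> a"
        by (metis affected_empty_iff all_not_in_conv in_affected)
      define \<tau> where "\<tau> = \<langle>a \<leftrightarrow> \<sigma> \<langle>$\<rangle> a\<rangle> * \<sigma>"
      have "\<langle>a \<leftrightarrow> \<sigma> \<langle>$\<rangle> a\<rangle> * \<tau> = (\<langle>a \<leftrightarrow> \<sigma> \<langle>$\<rangle> a\<rangle> * \<langle>a \<leftrightarrow> \<sigma> \<langle>$\<rangle> a\<rangle>) * \<sigma>"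
        unfolding \<tau>_def by (simp only: mult.assoc)
      then have \<tau>: "\<sigma> = \<langle>a \<leftrightarrow> \<sigma> \<langle>$\<rangle> a\<rangle> * \<tau>"
        by (simp only: swap_self mult_1_left)
      have apply_swap_6\<tau>: "\<tau> \<langle>$\<rangle> x = \<langle>a \<leftrightarrow> \<sigma> \<langle>$\<rangle> a\<rangle> \<langle>$\<rangle> (\<sigma> \<langle>$\<rangle> x)" for x
        by (simp only: \<tau>_def apply_times o_apply)
      have sub: "x \<in> affected \<sigma>" if "x \<in> affected \<tau>" for x
      proof (rule ccontr)
        assume "x \<notin> affected \<sigma>"
        then have fx: "\<sigma> \<langle>$\<rangle> x = x" by (simp only: in_affected not_not)
        then have "x \<noteq> a" using a by metis
        moreover have "x \<noteq> \<sigma> \<langle>$\<rangle> a" using fx \<open>x \<noteq> a\<close> apply_inj[of \<sigma> x a] by metis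
        ultimately have "\<tau> \<langle>$\<rangle> x = x" unfolding apply_swap_6\<tau> fx by (rule apply_swap_same)
        then show False using that by (simp only: in_affected)
      qed
      have "\<tau> \<langle>$\<rangle> a = a" unfolding apply_swap_6\<tau> by (rule apply_swap_simp)
      then have "a \<notin> affected \<tau>" by (simp only: in_affected not_not)
      moreover have "a \<in> affected \<sigma>" using a by (simp only: in_affected not_False_eq_True)
      ultimately have "affected \<tau> \<subset> affected \<sigma>" using sub by blast
      then have "P \<tau>" by (intro less psubset_card_mono finite_affected)
      then have "P (\<langle>a \<leftrightarrow> \<sigma> \<langle>$\<rangle> a\<rangle> * \<tau>)" by (rule mult[OF swap])
      then show ?thesis using arg_cong[OF \<tau>, of P] by iprover
    qed (use one in simp)
  qed
qed

lemma neq6: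
  "((1 :: 6) = 2) = False"
  "((1 :: 6) = 3) = False"
  "((1 :: 6) = 4) = False"
  "((1 :: 6) = 5) = False"
  "((1 :: 6) = 6) = False"
  "((2 :: 6) = 1) = False"
  "((2 :: 6) = 3) = False"
  "((2 :: 6) = 4) = False"
  "((2 :: 6) = 5) = False"
  "((2 :: 6) = 6) = False"
  "((3 :: 6) = 1) = False"
  "((3 :: 6) = 2) = False"
  "((3 :: 6) = 4) = False"
  "((3 :: 6) = 5) = False"
  "((3 :: 6) = 6) = False"
  "((4 :: 6) = 1) = False"
  "((4 :: 6) = 2) = False"
  "((4 :: 6) = 3) = False"
  "((4 :: 6) = 5) = False"
  "((4 :: 6) = 6) = False"
  "((5 :: 6) = 1) = False"
  "((5 :: 6) = 2) = False"
  "((5 :: 6) = 3) = False"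
  "((5 :: 6) = 4) = False"
  "((5 :: 6) = 6) = False"
  "((6 :: 6) = 1) = False"
  "((6 :: 6) = 2) = False"
  "((6 :: 6) = 3) = False"
  "((6 :: 6) = 4) = False"
  "((6 :: 6) = 5) = False"
  by simp_all

definition phi_inv :: "6 \<Rightarrow> 6 \<Rightarrow> 6 perm" where
  "phi_inv a b =
  (   if {a, b} = {1, 2} then \<langle>1 \<leftrightarrow> 5\<rangle> * \<langle>2 \<leftrightarrow> 3\<rangle> * \<langle>4 \<leftrightarrow> 6\<rangle>
   else if {a, b} = {1, 3} then \<langle>1 \<leftrightarrow> 4\<rangle> * \<langle>2 \<leftrightarrow> 5\<rangle> * \<langle>3 \<leftrightarrow> 6\<rangle>
   else if {a, b} = {1, 4} then \<langle>1 \<leftrightarrow> 3\<rangle> * \<langle>2 \<leftrightarrow> 6\<rangle> * \<langle>4 \<leftrightarrow> 5\<rangle>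
   else if {a, b} = {1, 5} then \<langle>1 \<leftrightarrow> 2\<rangle> * \<langle>3 \<leftrightarrow> 4\<rangle> * \<langle>5 \<leftrightarrow> 6\<rangle>
   else if {a, b} = {1, 6} then \<langle>1 \<leftrightarrow> 6\<rangle> * \<langle>2 \<leftrightarrow> 4\<rangle> * \<langle>3 \<leftrightarrow> 5\<rangle>
   else if {a, b} = {2, 3} then \<langle>1 \<leftrightarrow> 3\<rangle> * \<langle>2 \<leftrightarrow> 4\<rangle> * \<langle>5 \<leftrightarrow> 6\<rangle>
   else if {a, b} = {2, 4} then \<langle>1 \<leftrightarrow> 6\<rangle> * \<langle>2 \<leftrightarrow> 5\<rangle> * \<langle>3 \<leftrightarrow> 4\<rangle>
   else if {a, b} = {2, 5} then \<langle>1 \<leftrightarrow> 4\<rangle> * \<langle>2 \<leftrightarrow> 6\<rangle> * \<langle>3 \<leftrightarrow> 5\<rangle>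
   else if {a, b} = {2, 6} then \<langle>1 \<leftrightarrow> 2\<rangle> * \<langle>3 \<leftrightarrow> 6\<rangle> * \<langle>4 \<leftrightarrow> 5\<rangle>
   else if {a, b} = {3, 4} then \<langle>1 \<leftrightarrow> 2\<rangle> * \<langle>3 \<leftrightarrow> 5\<rangle> * \<langle>4 \<leftrightarrow> 6\<rangle>
   else if {a, b} = {3, 5} then \<langle>1 \<leftrightarrow> 6\<rangle> * \<langle>2 \<leftrightarrow> 3\<rangle> * \<langle>4 \<leftrightarrow> 5\<rangle>
   else if {a, b} = {3, 6} then \<langle>1 \<leftrightarrow> 5\<rangle> * \<langle>2 \<leftrightarrow> 6\<rangle> * \<langle>3 \<leftrightarrow> 4\<rangle>
   else if {a, b} = {4, 5} then \<langle>1 \<leftrightarrow> 5\<rangle> * \<langle>2 \<leftrightarrow> 4\<rangle> * \<langle>3 \<leftrightarrow> 6\<rangle>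
   else if {a, b} = {4, 6} then \<langle>1 \<leftrightarrow> 4\<rangle> * \<langle>2 \<leftrightarrow> 3\<rangle> * \<langle>5 \<leftrightarrow> 6\<rangle>
   else if {a, b} = {5, 6} then \<langle>1 \<leftrightarrow> 3\<rangle> * \<langle>2 \<leftrightarrow> 5\<rangle> * \<langle>4 \<leftrightarrow> 6\<rangle>
   else 1)"

definition pair_of :: "6 perm \<Rightarrow> 6 set" where
  "pair_of \<tau> =
  (if \<tau> \<langle>$\<rangle> 1 = 2 then (if \<tau> \<langle>$\<rangle> 3 = 4 then {1, 5} else if \<tau> \<langle>$\<rangle> 3 = 6 then {2, 6} else {3, 4})
   else if \<tau> \<langle>$\<rangle> 1 = 3 then (if \<tau> \<langle>$\<rangle> 2 = 6 then {1, 4} else if \<tau> \<langle>$\<rangle> 2 = 4 then {2, 3} else {5, 6})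
   else if \<tau> \<langle>$\<rangle> 1 = 4 then (if \<tau> \<langle>$\<rangle> 2 = 5 then {1, 3} else if \<tau> \<langle>$\<rangle> 2 = 6 then {2, 5} else {4, 6})
   else if \<tau> \<langle>$\<rangle> 1 = 5 then (if \<tau> \<langle>$\<rangle> 2 = 3 then {1, 2} else if \<tau> \<langle>$\<rangle> 2 = 6 then {3, 6} else {4, 5})
   else (if \<tau> \<langle>$\<rangle> 2 = 4 then {1, 6} else if \<tau> \<langle>$\<rangle> 2 = 5 then {2, 4} else {3, 5}))"

definition intertwines :: "6 perm \<Rightarrow> 6 perm \<Rightarrow> bool" where
  "intertwines \<sigma> \<rho> \<longleftrightarrow> (\<forall>a b. \<sigma> * phi_inv a b = phi_inv (\<rho> \<langle>$\<rangle> a) (\<rho> \<langle>$\<rangle> b) * \<sigma>)"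

lemma apply_swap_6:
  "\<langle>1 \<leftrightarrow> 2\<rangle> \<langle>$\<rangle> (1 :: 6) = 2"
  "\<langle>1 \<leftrightarrow> 2\<rangle> \<langle>$\<rangle> (2 :: 6) = 1"
  "\<langle>1 \<leftrightarrow> 2\<rangle> \<langle>$\<rangle> (3 :: 6) = 3"
  "\<langle>1 \<leftrightarrow> 2\<rangle> \<langle>$\<rangle> (4 :: 6) = 4"
  "\<langle>1 \<leftrightarrow> 2\<rangle> \<langle>$\<rangle> (5 :: 6) = 5"
  "\<langle>1 \<leftrightarrow> 2\<rangle> \<langle>$\<rangle> (6 :: 6) = 6"
  "\<langle>1 \<leftrightarrow> 3\<rangle> \<langle>$\<rangle> (1 :: 6) = 3"
  "\<langle>1 \<leftrightarrow> 3\<rangle> \<langle>$\<rangle> (2 :: 6) = 2"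
  "\<langle>1 \<leftrightarrow> 3\<rangle> \<langle>$\<rangle> (3 :: 6) = 1"
  "\<langle>1 \<leftrightarrow> 3\<rangle> \<langle>$\<rangle> (4 :: 6) = 4"
  "\<langle>1 \<leftrightarrow> 3\<rangle> \<langle>$\<rangle> (5 :: 6) = 5"
  "\<langle>1 \<leftrightarrow> 3\<rangle> \<langle>$\<rangle> (6 :: 6) = 6"
  "\<langle>1 \<leftrightarrow> 4\<rangle> \<langle>$\<rangle> (1 :: 6) = 4"
  "\<langle>1 \<leftrightarrow> 4\<rangle> \<langle>$\<rangle> (2 :: 6) = 2"
  "\<langle>1 \<leftrightarrow> 4\<rangle> \<langle>$\<rangle> (3 :: 6) = 3"
  "\<langle>1 \<leftrightarrow> 4\<rangle> \<langle>$\<rangle> (4 :: 6) = 1"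
  "\<langle>1 \<leftrightarrow> 4\<rangle> \<langle>$\<rangle> (5 :: 6) = 5"
  "\<langle>1 \<leftrightarrow> 4\<rangle> \<langle>$\<rangle> (6 :: 6) = 6"
  "\<langle>1 \<leftrightarrow> 5\<rangle> \<langle>$\<rangle> (1 :: 6) = 5"
  "\<langle>1 \<leftrightarrow> 5\<rangle> \<langle>$\<rangle> (2 :: 6) = 2"
  "\<langle>1 \<leftrightarrow> 5\<rangle> \<langle>$\<rangle> (3 :: 6) = 3"
  "\<langle>1 \<leftrightarrow> 5\<rangle> \<langle>$\<rangle> (4 :: 6) = 4"
  "\<langle>1 \<leftrightarrow> 5\<rangle> \<langle>$\<rangle> (5 :: 6) = 1"
  "\<langle>1 \<leftrightarrow> 5\<rangle> \<langle>$\<rangle> (6 :: 6) = 6"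
  "\<langle>1 \<leftrightarrow> 6\<rangle> \<langle>$\<rangle> (1 :: 6) = 6"
  "\<langle>1 \<leftrightarrow> 6\<rangle> \<langle>$\<rangle> (2 :: 6) = 2"
  "\<langle>1 \<leftrightarrow> 6\<rangle> \<langle>$\<rangle> (3 :: 6) = 3"
  "\<langle>1 \<leftrightarrow> 6\<rangle> \<langle>$\<rangle> (4 :: 6) = 4"
  "\<langle>1 \<leftrightarrow> 6\<rangle> \<langle>$\<rangle> (5 :: 6) = 5"
  "\<langle>1 \<leftrightarrow> 6\<rangle> \<langle>$\<rangle> (6 :: 6) = 1"
  "\<langle>2 \<leftrightarrow> 3\<rangle> \<langle>$\<rangle> (1 :: 6) = 1"
  "\<langle>2 \<leftrightarrow> 3\<rangle> \<langle>$\<rangle> (2 :: 6) = 3"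
  "\<langle>2 \<leftrightarrow> 3\<rangle> \<langle>$\<rangle> (3 :: 6) = 2"
  "\<langle>2 \<leftrightarrow> 3\<rangle> \<langle>$\<rangle> (4 :: 6) = 4"
  "\<langle>2 \<leftrightarrow> 3\<rangle> \<langle>$\<rangle> (5 :: 6) = 5"
  "\<langle>2 \<leftrightarrow> 3\<rangle> \<langle>$\<rangle> (6 :: 6) = 6"
  "\<langle>2 \<leftrightarrow> 4\<rangle> \<langle>$\<rangle> (1 :: 6) = 1"
  "\<langle>2 \<leftrightarrow> 4\<rangle> \<langle>$\<rangle> (2 :: 6) = 4"
  "\<langle>2 \<leftrightarrow> 4\<rangle> \<langle>$\<rangle> (3 :: 6) = 3"
  "\<langle>2 \<leftrightarrow> 4\<rangle> \<langle>$\<rangle> (4 :: 6) = 2"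
  "\<langle>2 \<leftrightarrow> 4\<rangle> \<langle>$\<rangle> (5 :: 6) = 5"
  "\<langle>2 \<leftrightarrow> 4\<rangle> \<langle>$\<rangle> (6 :: 6) = 6"
  "\<langle>2 \<leftrightarrow> 5\<rangle> \<langle>$\<rangle> (1 :: 6) = 1"
  "\<langle>2 \<leftrightarrow> 5\<rangle> \<langle>$\<rangle> (2 :: 6) = 5"
  "\<langle>2 \<leftrightarrow> 5\<rangle> \<langle>$\<rangle> (3 :: 6) = 3"
  "\<langle>2 \<leftrightarrow> 5\<rangle> \<langle>$\<rangle> (4 :: 6) = 4"
  "\<langle>2 \<leftrightarrow> 5\<rangle> \<langle>$\<rangle> (5 :: 6) = 2"
  "\<langle>2 \<leftrightarrow> 5\<rangle> \<langle>$\<rangle> (6 :: 6) = 6"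
  "\<langle>2 \<leftrightarrow> 6\<rangle> \<langle>$\<rangle> (1 :: 6) = 1"
  "\<langle>2 \<leftrightarrow> 6\<rangle> \<langle>$\<rangle> (2 :: 6) = 6"
  "\<langle>2 \<leftrightarrow> 6\<rangle> \<langle>$\<rangle> (3 :: 6) = 3"
  "\<langle>2 \<leftrightarrow> 6\<rangle> \<langle>$\<rangle> (4 :: 6) = 4"
  "\<langle>2 \<leftrightarrow> 6\<rangle> \<langle>$\<rangle> (5 :: 6) = 5"
  "\<langle>2 \<leftrightarrow> 6\<rangle> \<langle>$\<rangle> (6 :: 6) = 2"
  "\<langle>3 \<leftrightarrow> 4\<rangle> \<langle>$\<rangle> (1 :: 6) = 1"
  "\<langle>3 \<leftrightarrow> 4\<rangle> \<langle>$\<rangle> (2 :: 6) = 2"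
  "\<langle>3 \<leftrightarrow> 4\<rangle> \<langle>$\<rangle> (3 :: 6) = 4"
  "\<langle>3 \<leftrightarrow> 4\<rangle> \<langle>$\<rangle> (4 :: 6) = 3"
  "\<langle>3 \<leftrightarrow> 4\<rangle> \<langle>$\<rangle> (5 :: 6) = 5"
  "\<langle>3 \<leftrightarrow> 4\<rangle> \<langle>$\<rangle> (6 :: 6) = 6"
  "\<langle>3 \<leftrightarrow> 5\<rangle> \<langle>$\<rangle> (1 :: 6) = 1"
  "\<langle>3 \<leftrightarrow> 5\<rangle> \<langle>$\<rangle> (2 :: 6) = 2"
  "\<langle>3 \<leftrightarrow> 5\<rangle> \<langle>$\<rangle> (3 :: 6) = 5"
  "\<langle>3 \<leftrightarrow> 5\<rangle> \<langle>$\<rangle> (4 :: 6) = 4"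
  "\<langle>3 \<leftrightarrow> 5\<rangle> \<langle>$\<rangle> (5 :: 6) = 3"
  "\<langle>3 \<leftrightarrow> 5\<rangle> \<langle>$\<rangle> (6 :: 6) = 6"
  "\<langle>3 \<leftrightarrow> 6\<rangle> \<langle>$\<rangle> (1 :: 6) = 1"
  "\<langle>3 \<leftrightarrow> 6\<rangle> \<langle>$\<rangle> (2 :: 6) = 2"
  "\<langle>3 \<leftrightarrow> 6\<rangle> \<langle>$\<rangle> (3 :: 6) = 6"
  "\<langle>3 \<leftrightarrow> 6\<rangle> \<langle>$\<rangle> (4 :: 6) = 4"
  "\<langle>3 \<leftrightarrow> 6\<rangle> \<langle>$\<rangle> (5 :: 6) = 5"
  "\<langle>3 \<leftrightarrow> 6\<rangle> \<langle>$\<rangle> (6 :: 6) = 3"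
  "\<langle>4 \<leftrightarrow> 5\<rangle> \<langle>$\<rangle> (1 :: 6) = 1"
  "\<langle>4 \<leftrightarrow> 5\<rangle> \<langle>$\<rangle> (2 :: 6) = 2"
  "\<langle>4 \<leftrightarrow> 5\<rangle> \<langle>$\<rangle> (3 :: 6) = 3"
  "\<langle>4 \<leftrightarrow> 5\<rangle> \<langle>$\<rangle> (4 :: 6) = 5"
  "\<langle>4 \<leftrightarrow> 5\<rangle> \<langle>$\<rangle> (5 :: 6) = 4"
  "\<langle>4 \<leftrightarrow> 5\<rangle> \<langle>$\<rangle> (6 :: 6) = 6"
  "\<langle>4 \<leftrightarrow> 6\<rangle> \<langle>$\<rangle> (1 :: 6) = 1"
  "\<langle>4 \<leftrightarrow> 6\<rangle> \<langle>$\<rangle> (2 :: 6) = 2"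
  "\<langle>4 \<leftrightarrow> 6\<rangle> \<langle>$\<rangle> (3 :: 6) = 3"
  "\<langle>4 \<leftrightarrow> 6\<rangle> \<langle>$\<rangle> (4 :: 6) = 6"
  "\<langle>4 \<leftrightarrow> 6\<rangle> \<langle>$\<rangle> (5 :: 6) = 5"
  "\<langle>4 \<leftrightarrow> 6\<rangle> \<langle>$\<rangle> (6 :: 6) = 4"
  "\<langle>5 \<leftrightarrow> 6\<rangle> \<langle>$\<rangle> (1 :: 6) = 1"
  "\<langle>5 \<leftrightarrow> 6\<rangle> \<langle>$\<rangle> (2 :: 6) = 2"
  "\<langle>5 \<leftrightarrow> 6\<rangle> \<langle>$\<rangle> (3 :: 6) = 3"
  "\<langle>5 \<leftrightarrow> 6\<rangle> \<langle>$\<rangle> (4 :: 6) = 4"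
  "\<langle>5 \<leftrightarrow> 6\<rangle> \<langle>$\<rangle> (5 :: 6) = 6"
  "\<langle>5 \<leftrightarrow> 6\<rangle> \<langle>$\<rangle> (6 :: 6) = 5"
  by (simp_all only: apply_swap_simp apply_swap_same neq6 not_False_eq_True)

lemma phi_inv_simps:
  "phi_inv 1 1 = 1"
  "phi_inv 1 2 = \<langle>1 \<leftrightarrow> 5\<rangle> * \<langle>2 \<leftrightarrow> 3\<rangle> * \<langle>4 \<leftrightarrow> 6\<rangle>"
  "phi_inv 1 3 = \<langle>1 \<leftrightarrow> 4\<rangle> * \<langle>2 \<leftrightarrow> 5\<rangle> * \<langle>3 \<leftrightarrow> 6\<rangle>"
  "phi_inv 1 4 = \<langle>1 \<leftrightarrow> 3\<rangle> * \<langle>2 \<leftrightarrow> 6\<rangle> * \<langle>4 \<leftrightarrow> 5\<rangle>"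
  "phi_inv 1 5 = \<langle>1 \<leftrightarrow> 2\<rangle> * \<langle>3 \<leftrightarrow> 4\<rangle> * \<langle>5 \<leftrightarrow> 6\<rangle>"
  "phi_inv 1 6 = \<langle>1 \<leftrightarrow> 6\<rangle> * \<langle>2 \<leftrightarrow> 4\<rangle> * \<langle>3 \<leftrightarrow> 5\<rangle>"
  "phi_inv 2 1 = \<langle>1 \<leftrightarrow> 5\<rangle> * \<langle>2 \<leftrightarrow> 3\<rangle> * \<langle>4 \<leftrightarrow> 6\<rangle>"
  "phi_inv 2 2 = 1"
  "phi_inv 2 3 = \<langle>1 \<leftrightarrow> 3\<rangle> * \<langle>2 \<leftrightarrow> 4\<rangle> * \<langle>5 \<leftrightarrow> 6\<rangle>"
  "phi_inv 2 4 = \<langle>1 \<leftrightarrow> 6\<rangle> * \<langle>2 \<leftrightarrow> 5\<rangle> * \<langle>3 \<leftrightarrow> 4\<rangle>"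
  "phi_inv 2 5 = \<langle>1 \<leftrightarrow> 4\<rangle> * \<langle>2 \<leftrightarrow> 6\<rangle> * \<langle>3 \<leftrightarrow> 5\<rangle>"
  "phi_inv 2 6 = \<langle>1 \<leftrightarrow> 2\<rangle> * \<langle>3 \<leftrightarrow> 6\<rangle> * \<langle>4 \<leftrightarrow> 5\<rangle>"
  "phi_inv 3 1 = \<langle>1 \<leftrightarrow> 4\<rangle> * \<langle>2 \<leftrightarrow> 5\<rangle> * \<langle>3 \<leftrightarrow> 6\<rangle>"
  "phi_inv 3 2 = \<langle>1 \<leftrightarrow> 3\<rangle> * \<langle>2 \<leftrightarrow> 4\<rangle> * \<langle>5 \<leftrightarrow> 6\<rangle>"
  "phi_inv 3 3 = 1"
  "phi_inv 3 4 = \<langle>1 \<leftrightarrow> 2\<rangle> * \<langle>3 \<leftrightarrow> 5\<rangle> * \<langle>4 \<leftrightarrow> 6\<rangle>"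
  "phi_inv 3 5 = \<langle>1 \<leftrightarrow> 6\<rangle> * \<langle>2 \<leftrightarrow> 3\<rangle> * \<langle>4 \<leftrightarrow> 5\<rangle>"
  "phi_inv 3 6 = \<langle>1 \<leftrightarrow> 5\<rangle> * \<langle>2 \<leftrightarrow> 6\<rangle> * \<langle>3 \<leftrightarrow> 4\<rangle>"
  "phi_inv 4 1 = \<langle>1 \<leftrightarrow> 3\<rangle> * \<langle>2 \<leftrightarrow> 6\<rangle> * \<langle>4 \<leftrightarrow> 5\<rangle>"
  "phi_inv 4 2 = \<langle>1 \<leftrightarrow> 6\<rangle> * \<langle>2 \<leftrightarrow> 5\<rangle> * \<langle>3 \<leftrightarrow> 4\<rangle>"
  "phi_inv 4 3 = \<langle>1 \<leftrightarrow> 2\<rangle> * \<langle>3 \<leftrightarrow> 5\<rangle> * \<langle>4 \<leftrightarrow> 6\<rangle>"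
  "phi_inv 4 4 = 1"
  "phi_inv 4 5 = \<langle>1 \<leftrightarrow> 5\<rangle> * \<langle>2 \<leftrightarrow> 4\<rangle> * \<langle>3 \<leftrightarrow> 6\<rangle>"
  "phi_inv 4 6 = \<langle>1 \<leftrightarrow> 4\<rangle> * \<langle>2 \<leftrightarrow> 3\<rangle> * \<langle>5 \<leftrightarrow> 6\<rangle>"
  "phi_inv 5 1 = \<langle>1 \<leftrightarrow> 2\<rangle> * \<langle>3 \<leftrightarrow> 4\<rangle> * \<langle>5 \<leftrightarrow> 6\<rangle>"
  "phi_inv 5 2 = \<langle>1 \<leftrightarrow> 4\<rangle> * \<langle>2 \<leftrightarrow> 6\<rangle> * \<langle>3 \<leftrightarrow> 5\<rangle>"
  "phi_inv 5 3 = \<langle>1 \<leftrightarrow> 6\<rangle> * \<langle>2 \<leftrightarrow> 3\<rangle> * \<langle>4 \<leftrightarrow> 5\<rangle>"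
  "phi_inv 5 4 = \<langle>1 \<leftrightarrow> 5\<rangle> * \<langle>2 \<leftrightarrow> 4\<rangle> * \<langle>3 \<leftrightarrow> 6\<rangle>"
  "phi_inv 5 5 = 1"
  "phi_inv 5 6 = \<langle>1 \<leftrightarrow> 3\<rangle> * \<langle>2 \<leftrightarrow> 5\<rangle> * \<langle>4 \<leftrightarrow> 6\<rangle>"
  "phi_inv 6 1 = \<langle>1 \<leftrightarrow> 6\<rangle> * \<langle>2 \<leftrightarrow> 4\<rangle> * \<langle>3 \<leftrightarrow> 5\<rangle>"
  "phi_inv 6 2 = \<langle>1 \<leftrightarrow> 2\<rangle> * \<langle>3 \<leftrightarrow> 6\<rangle> * \<langle>4 \<leftrightarrow> 5\<rangle>"
  "phi_inv 6 3 = \<langle>1 \<leftrightarrow> 5\<rangle> * \<langle>2 \<leftrightarrow> 6\<rangle> * \<langle>3 \<leftrightarrow> 4\<rangle>"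
  "phi_inv 6 4 = \<langle>1 \<leftrightarrow> 4\<rangle> * \<langle>2 \<leftrightarrow> 3\<rangle> * \<langle>5 \<leftrightarrow> 6\<rangle>"
  "phi_inv 6 5 = \<langle>1 \<leftrightarrow> 3\<rangle> * \<langle>2 \<leftrightarrow> 5\<rangle> * \<langle>4 \<leftrightarrow> 6\<rangle>"
  "phi_inv 6 6 = 1"
  by (simp_all only: phi_inv_def doubleton_eq_iff neq6 simp_thms if_True if_False cong: if_weak_cong)


lemma pair_of_phi_inv: "a \<noteq> b \<Longrightarrow> pair_of (phi_inv a b) = {a, b}"
proof -
  have "\<forall>a b. a \<noteq> b \<longrightarrow> pair_of (phi_inv a b) = {a, b}"
    by (simp only: all_6 pair_of_def phi_inv_simps apply_times o_apply apply_swap_6 neq6 simp_thms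
        if_True if_False insert_commute cong: if_weak_cong)
  then show "a \<noteq> b \<Longrightarrow> pair_of (phi_inv a b) = {a, b}" by blast
qed

lemma intertwines_adjacent:
  "intertwines \<langle>1 \<leftrightarrow> 2\<rangle> (\<langle>1 \<leftrightarrow> 5\<rangle> * \<langle>2 \<leftrightarrow> 6\<rangle> * \<langle>3 \<leftrightarrow> 4\<rangle>)"
  "intertwines \<langle>2 \<leftrightarrow> 3\<rangle> (\<langle>1 \<leftrightarrow> 2\<rangle> * \<langle>3 \<leftrightarrow> 5\<rangle> * \<langle>4 \<leftrightarrow> 6\<rangle>)"
  "intertwines \<langle>3 \<leftrightarrow> 4\<rangle> (\<langle>1 \<leftrightarrow> 5\<rangle> * \<langle>2 \<leftrightarrow> 4\<rangle> * \<langle>3 \<leftrightarrow> 6\<rangle>)"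
  "intertwines \<langle>4 \<leftrightarrow> 5\<rangle> (\<langle>1 \<leftrightarrow> 4\<rangle> * \<langle>2 \<leftrightarrow> 6\<rangle> * \<langle>3 \<leftrightarrow> 5\<rangle>)"
  "intertwines \<langle>5 \<leftrightarrow> 6\<rangle> (\<langle>1 \<leftrightarrow> 5\<rangle> * \<langle>2 \<leftrightarrow> 3\<rangle> * \<langle>4 \<leftrightarrow> 6\<rangle>)"
  by (simp_all only: intertwines_def perm_eq_iff all_6 phi_inv_simps apply_times o_apply apply_swap_6
      apply_one id_apply simp_thms)

lemma intertwines_phi_inv:
  "intertwines (\<langle>1 \<leftrightarrow> 5\<rangle> * \<langle>2 \<leftrightarrow> 3\<rangle> * \<langle>4 \<leftrightarrow> 6\<rangle>) \<langle>1 \<leftrightarrow> 2\<rangle>"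
  "intertwines (\<langle>1 \<leftrightarrow> 3\<rangle> * \<langle>2 \<leftrightarrow> 4\<rangle> * \<langle>5 \<leftrightarrow> 6\<rangle>) \<langle>2 \<leftrightarrow> 3\<rangle>"
  "intertwines (\<langle>1 \<leftrightarrow> 2\<rangle> * \<langle>3 \<leftrightarrow> 5\<rangle> * \<langle>4 \<leftrightarrow> 6\<rangle>) \<langle>3 \<leftrightarrow> 4\<rangle>"
  "intertwines (\<langle>1 \<leftrightarrow> 5\<rangle> * \<langle>2 \<leftrightarrow> 4\<rangle> * \<langle>3 \<leftrightarrow> 6\<rangle>) \<langle>4 \<leftrightarrow> 5\<rangle>"
  "intertwines (\<langle>1 \<leftrightarrow> 3\<rangle> * \<langle>2 \<leftrightarrow> 5\<rangle> * \<langle>4 \<leftrightarrow> 6\<rangle>) \<langle>5 \<leftrightarrow> 6\<rangle>"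
  by (simp_all only: intertwines_def perm_eq_iff all_6 phi_inv_simps apply_times o_apply apply_swap_6
      apply_one id_apply simp_thms)

lemma intertwines_one: "intertwines 1 1"
  by (simp add: intertwines_def)

lemma intertwines_mult:
  assumes "intertwines \<sigma> \<rho>" "intertwines \<sigma>' \<rho>'"
  shows "intertwines (\<sigma> * \<sigma>') (\<rho> * \<rho>')"
  unfolding intertwines_def
proof (intro allI)
  fix a b
  have "\<sigma> * \<sigma>' * phi_inv a b = \<sigma> * (\<sigma>' * phi_inv a b)" by (simp only: mult.assoc)
  also have "\<dots> = \<sigma> * phi_inv (\<rho>' \<langle>$\<rangle> a) (\<rho>' \<langle>$\<rangle> b) * \<sigma>'"
    using assms(2) by (simp only: intertwines_def mult.assoc)
  also have "\<dots> = phi_inv ((\<rho> * \<rho>') \<langle>$\<rangle> a) ((\<rho> * \<rho>') \<langle>$\<rangle> b) * (\<sigma> * \<sigma>')"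
    using assms(1) by (simp only: intertwines_def mult.assoc apply_times o_apply)
  finally show "\<sigma> * \<sigma>' * phi_inv a b = phi_inv ((\<rho> * \<rho>') \<langle>$\<rangle> a) ((\<rho> * \<rho>') \<langle>$\<rangle> b) * (\<sigma> * \<sigma>')" .
qed

lemma intertwines_exists: "\<exists>\<rho>. intertwines \<sigma> \<rho>"
proof (induction \<sigma> rule: perm6_induct)
  case (2 \<sigma> \<tau>)
  then show ?case using intertwines_mult by blast
qed (use intertwines_one intertwines_adjacent in blast)+

lemma intertwines_unique:
  assumes "intertwines \<sigma> \<rho>" "intertwines \<sigma> \<rho>'"
  shows "\<rho> = \<rho>'"
proof (rule perm_eqI, rule ccontr)
  fix a assume ne: "\<rho> \<langle>$\<rangle> a \<noteq> \<rho>' \<langle>$\<rangle> a"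
  have pair: "{\<rho> \<langle>$\<rangle> a, \<rho> \<langle>$\<rangle> b} = {\<rho>' \<langle>$\<rangle> a, \<rho>' \<langle>$\<rangle> b}" if "a \<noteq> b" for b
  proof -
    have "phi_inv (\<rho> \<langle>$\<rangle> a) (\<rho> \<langle>$\<rangle> b) = phi_inv (\<rho>' \<langle>$\<rangle> a) (\<rho>' \<langle>$\<rangle> b)"
      using assms perm.right_cancel unfolding intertwines_def by metis
    then show ?thesis using that pair_of_phi_inv apply_inj by metis
  qed
  have "\<exists>b c :: 6. b \<noteq> a \<and> c \<noteq> a \<and> b \<noteq> c"
    using neq6 by metis
  then obtain b c where bc: "b \<noteq> a" "c \<noteq> a" "b \<noteq> c" by blast
  then have "\<rho> \<langle>$\<rangle> a = \<rho>' \<langle>$\<rangle> b" "\<rho> \<langle>$\<rangle> a = \<rho>' \<langle>$\<rangle> c"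
    using pair[of b] pair[of c] ne by (auto simp only: doubleton_eq_iff)
  then show False using bc apply_inj by metis
qed

lemma ex1_is_outer_phi: "\<exists>!f. is_outer_phi f"
proof -
  define f where "f \<sigma> = (THE \<rho>. intertwines \<sigma> \<rho>)" for \<sigma>
  have f_eq: "f \<sigma> = \<rho>" if "intertwines \<sigma> \<rho>" for \<sigma> \<rho>
    unfolding f_def using that intertwines_unique by blast
  have f: "intertwines \<sigma> (f \<sigma>)" for \<sigma>
    using intertwines_exists f_eq by metis
  have mult: "f (\<sigma> * \<tau>) = f \<sigma> * f \<tau>" for \<sigma> \<tau>
    by (intro f_eq intertwines_mult f)
  have surj: "\<exists>\<sigma>. f \<sigma> = \<tau>" for \<tau>
  proof (induction \<tau> rule: perm6_induct)
    case (2 \<sigma> \<tau>)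
    then show ?case using mult by metis
  qed (use f_eq intertwines_one intertwines_phi_inv in blast)+
  have "finite (range ((\<langle>$\<rangle>) :: 6 perm \<Rightarrow> _))" by simp
  moreover have "inj ((\<langle>$\<rangle>) :: 6 perm \<Rightarrow> _)" by (intro injI) (simp add: perm_eq_iff)
  ultimately have "finite (UNIV :: 6 perm set)" by (rule finite_imageD)
  moreover have "surj f" using surj by (metis surjI)
  ultimately have "bij f" by (simp add: bij_def finite_UNIV_surj_inj)
  then have is_f: "is_outer_phi f"
    unfolding is_outer_phi_def using mult f_eq[OF intertwines_adjacent(1)]
      f_eq[OF intertwines_adjacent(2)] f_eq[OF intertwines_adjacent(3)]
      f_eq[OF intertwines_adjacent(4)] f_eq[OF intertwines_adjacent(5)] by blast
  have "g = f" if g: "is_outer_phi g" for g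
  proof
    fix \<sigma>
    have one: "h 1 = 1" if "is_outer_phi h" for h
    proof -
      have "h 1 * h 1 = h 1 * 1" using that unfolding is_outer_phi_def by (metis mult_1_right)
      then show ?thesis by (simp only: perm.left_cancel)
    qed
    show "g \<sigma> = f \<sigma>"
    proof (induction \<sigma> rule: perm6_induct)
      case 1
      show ?case using one[OF g] one[OF is_f] by (rule trans[OF _ sym])
    next
      case (2 \<sigma> \<tau>)
      then show ?case using g mult unfolding is_outer_phi_def by metis
    qed (use g is_f in \<open>simp_all only: is_outer_phi_def\<close>)
  qed
  then show ?thesis using is_f by blast
qed

lemma is_outer_phi_outer_phi: "is_outer_phi outer_phi"
  unfolding outer_phi_def using ex1_is_outer_phi by (rule theI')

end

theory Submission
  imports Defs
begin

text \<open>
  A simple 4-set of triples consists of triples pairwise meeting in one point, hence is a Pasch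
  configuration, the configuration attached to one of the 15 synthemes
  \<open>\<sigma> = (p\<^sub>1p\<^sub>4)(p\<^sub>2p\<^sub>5)(p\<^sub>3p\<^sub>6)\<close>. Its four hyperplanes are linearly dependent exactly when \<open>\<sigma>\<close> is
  induced by a projectivity: in the coordinates given by \<open>\<alpha>\<^bsub>p\<^sub>1\<^esub>\<close> and \<open>\<alpha>\<^bsub>p\<^sub>4\<^esub>\<close>, both conditions become the
  same quartic equation. The permutations induced by projectivities are closed under products, and
  \<open>(i k) = (i j)(j k)(i j)\<close>, so \<open>\<phi>((i j))\<close> being induced by a projectivity is an equivalence
  relation on \<open>i, j\<close>; its classes are the blocks of the partition.

  Uniqueness and the count need that a quadral point determines its 4-set. If a quadral point were
  contained in a further \<open>D\<^sub>L\<close>, four of the six lines would be concurrent, and then the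
  configuration forces all six to be concurrent, which has codimension 4.
\<close>

subsection \<open>The six linear forms\<close>

locale generic_lines =
  fixes \<alpha> :: "6 \<Rightarrow> 'a::field ^ 2 \<Rightarrow> 'a"
  assumes generic: "generic_arrangement \<alpha>"
begin

lemma linear_form: "Vector_Spaces.linear (*s) (*) (\<alpha> i)"
  using generic by (simp add: generic_arrangement_def)

lemma form_add: "\<alpha> i (v + w) = \<alpha> i v + \<alpha> i w"
  using linear_form[of i] by (simp add: Vector_Spaces.linear_iff)

lemma form_scale: "\<alpha> i (c *s v) = c * \<alpha> i v"
  using linear_form[of i] by (simp add: Vector_Spaces.linear_iff)

lemma form_nonzero: "\<exists>v. \<alpha> i v \<noteq> 0"
  using generic by (simp add: generic_arrangement_def)

lemma form_coordinates: "\<alpha> i v = \<alpha> i (axis 1 1) * v $ 1 + \<alpha> i (axis 2 1) * v $ 2"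
proof -
  have "v = v $ 1 *s axis 1 1 + v $ 2 *s axis 2 1"
    by (simp add: vec_eq_iff forall_2 axis_def)
  then have "\<alpha> i v = \<alpha> i (v $ 1 *s axis 1 1 + v $ 2 *s axis 2 1)" by simp
  also have "\<dots> = \<alpha> i (axis 1 1) * v $ 1 + \<alpha> i (axis 2 1) * v $ 2"
    by (simp only: form_add form_scale mult.commute)
  finally show ?thesis .
qed

text \<open>Forms with proportional coefficient vectors have the same kernel, while the six lines
  are distinct.\<close>

lemma det_forms_nonzero:
  assumes "i \<noteq> j"
  shows "\<alpha> i (axis 1 1) * \<alpha> j (axis 2 1) - \<alpha> j (axis 1 1) * \<alpha> i (axis 2 1) \<noteq> 0"
proof
  let ?a = "\<lambda>i. \<alpha> i (axis 1 1)" and ?b = "\<lambda>i. \<alpha> i (axis 2 1)"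
  assume det: "?a i * ?b j - ?a j * ?b i = 0"
  have nz: "?a k \<noteq> 0 \<or> ?b k \<noteq> 0" for k
  proof -
    obtain v where "\<alpha> k v \<noteq> 0" using form_nonzero by blast
    then have "?a k * v $ 1 + ?b k * v $ 2 \<noteq> 0" by (subst (asm) form_coordinates)
    then show ?thesis by auto
  qed
  \<comment> \<open>Either coefficient of \<open>\<alpha> k\<close> times
    \<open>\<alpha> l v\<close> is a multiple of \<open>\<alpha> k v\<close>, and one of the two
    coefficients is nonzero.\<close>
  have sub: "\<alpha> l v = 0" if kv: "\<alpha> k v = 0" and d: "?a k * ?b l = ?a l * ?b k" for k l v
  proof -
    have e: "?a k * v $ 1 + ?b k * v $ 2 = 0" using kv form_coordinates[of k v] by simp
    have "?a k * (?a l * v $ 1 + ?b l * v $ 2) = ?a l * (?a k * v $ 1 + ?b k * v $ 2)"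
      using d by (simp add: algebra_simps)
    moreover have "?b k * (?a l * v $ 1 + ?b l * v $ 2) = ?b l * (?a k * v $ 1 + ?b k * v $ 2)"
      using d by (simp add: algebra_simps)
    ultimately have "?a l * v $ 1 + ?b l * v $ 2 = 0"
      using e nz[of k] by auto
    then show ?thesis by (subst form_coordinates)
  qed
  have "{v. \<alpha> i v = 0} = {v. \<alpha> j v = 0}"
    using sub[of i _ j] sub[of j _ i] det by auto
  moreover have "inj (\<lambda>i. {v. \<alpha> i v = 0})"
    using generic by (simp add: generic_arrangement_def)
  ultimately show False using assms unfolding inj_def by blast
qed

lemma ex_common_point:
  assumes "i \<noteq> j"
  shows "\<exists>v. \<alpha> i v = x \<and> \<alpha> j v = y"
proof -
  let ?a = "\<lambda>i. \<alpha> i (axis 1 1)" and ?b = "\<lambda>i. \<alpha> i (axis 2 1)"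
  define d where "d = ?a i * ?b j - ?a j * ?b i"
  have d: "d \<noteq> 0" unfolding d_def by (rule det_forms_nonzero[OF assms])
  \<comment> \<open>The solution of the two equations by Cramer's rule.\<close>
  define v :: "'a ^ 2" where
    "v = (1 / d) *s (\<chi> k. if k = 1 then ?b j * x - ?b i * y else ?a i * y - ?a j * x)"
  have v: "v $ 1 = (?b j * x - ?b i * y) / d" "v $ 2 = (?a i * y - ?a j * x) / d"
    by (simp_all add: v_def)
  have "?a i * v $ 1 + ?b i * v $ 2 = d * x / d"
    unfolding v d_def by (simp add: add_divide_distrib[symmetric] algebra_simps)
  moreover have "?a j * v $ 1 + ?b j * v $ 2 = d * y / d"
    unfolding v d_def by (simp add: add_divide_distrib[symmetric] algebra_simps)
  ultimately show ?thesis
    using d form_coordinates[of i v] form_coordinates[of j v] by auto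
qed

lemma common_point_unique:
  assumes ij: "i \<noteq> j" and i: "\<alpha> i v = \<alpha> i w" and j: "\<alpha> j v = \<alpha> j w"
  shows "v = w"
proof -
  let ?a = "\<lambda>i. \<alpha> i (axis 1 1)" and ?b = "\<lambda>i. \<alpha> i (axis 2 1)"
  have e: "?a i * v $ 1 + ?b i * v $ 2 = ?a i * w $ 1 + ?b i * w $ 2"
    "?a j * v $ 1 + ?b j * v $ 2 = ?a j * w $ 1 + ?b j * w $ 2"
    using i j form_coordinates by metis+
  have "(?a i * ?b j - ?a j * ?b i) * (v $ 1 - w $ 1) = 0" using e by algebra
  moreover have "(?a i * ?b j - ?a j * ?b i) * (v $ 2 - w $ 2) = 0" using e by algebra
  ultimately show ?thesis
    using det_forms_nonzero[OF ij] by (auto simp: vec_eq_iff forall_2)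
qed

text \<open>Two of the forms serve as coordinates of the plane; \<open>a k\<close> and
  \<open>b k\<close> are the values of \<open>\<alpha> k\<close> on the basis dual to them. In this
  frame concurrency and projectivities become polynomial conditions on \<open>a\<close> and
  \<open>b\<close>.\<close>

lemma ex_frame_coordinates:
  assumes ij: "i \<noteq> j"
  obtains a b where "\<And>k v. \<alpha> k v = a k * \<alpha> i v + b k * \<alpha> j v"
    and "\<And>k l. k \<noteq> l \<Longrightarrow> a k * b l - a l * b k \<noteq> 0"
    and "a i = 1" "b i = 0" "a j = 0" "b j = 1"
proof -
  obtain u w where u: "\<alpha> i u = 1" "\<alpha> j u = 0" and w: "\<alpha> i w = 0" "\<alpha> j w = 1"
    using ex_common_point[OF ij] by metis
  define a b where "a k = \<alpha> k u" and "b k = \<alpha> k w" for k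
  have v: "v = \<alpha> i v *s u + \<alpha> j v *s w" for v
    by (rule common_point_unique[OF ij]) (simp_all add: form_add form_scale u w)
  have comb: "\<alpha> k v = a k * \<alpha> i v + b k * \<alpha> j v" for k v
  proof -
    have "\<alpha> k v = \<alpha> k (\<alpha> i v *s u + \<alpha> j v *s w)" using v[of v] by simp
    then show ?thesis by (simp add: form_add form_scale a_def b_def mult.commute)
  qed
  have det: "a k * b l - a l * b k \<noteq> 0" if kl: "k \<noteq> l" for k l
  proof
    assume d: "a k * b l - a l * b k = 0"
    \<comment> \<open>This vector always lies in the kernel of \<open>\<alpha> k\<close>. A
      vanishing determinant puts it into the kernel of \<open>\<alpha> l\<close> as well, so it is
      zero, and then \<open>\<alpha> k\<close> vanishes identically.\<close>
    obtain z where z: "\<alpha> i z = b k" "\<alpha> j z = - a k" using ex_common_point[OF ij] by blast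
    have zero: "\<alpha> m 0 = 0" for m using form_scale[of m 0 0] by simp
    have "\<alpha> k z = \<alpha> k 0" "\<alpha> l z = \<alpha> l 0"
      unfolding zero using d by (subst comb, simp add: z algebra_simps)+
    then have "z = 0" by (rule common_point_unique[OF kl])
    then have "a k = 0" "b k = 0" using z zero by auto
    then show False using form_nonzero[of k] comb[of k] by simp
  qed
  show ?thesis using that[OF comb det] by (simp add: a_def b_def u w)
qed


subsection \<open>Concurrent translates\<close>

definition concurrent :: "'a ^ 6 \<Rightarrow> 6 set \<Rightarrow> bool" where
  "concurrent x S \<longleftrightarrow> (\<exists>v. \<forall>i\<in>S. \<alpha> i v = x $ i)"

lemma D_triple_eq: "D_triple \<alpha> L = {x. concurrent x L}"
  by (auto simp: D_triple_def translate_def concurrent_def)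

lemma concurrent_mono: "concurrent x S \<Longrightarrow> S' \<subseteq> S \<Longrightarrow> concurrent x S'"
  by (auto simp: concurrent_def)

text \<open>Both common points lie on the two non-parallel lines \<open>i\<close> and
  \<open>j\<close>, hence coincide.\<close>

lemma concurrent_Un:
  assumes S: "concurrent x S" and S': "concurrent x S'"
    and ij: "i \<noteq> j" "i \<in> S" "j \<in> S" "i \<in> S'" "j \<in> S'"
  shows "concurrent x (S \<union> S')"
proof -
  obtain v w where v: "\<forall>k\<in>S. \<alpha> k v = x $ k" and w: "\<forall>k\<in>S'. \<alpha> k w = x $ k"
    using S S' unfolding concurrent_def by blast
  have "v = w" by (rule common_point_unique[OF ij(1)]) (use v w ij in auto)
  then show ?thesis using v w unfolding concurrent_def by blast
qed

lemma D_set_eq: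
  assumes "card S \<ge> 3"
  shows "D_set \<alpha> S = {x. concurrent x S}"
proof
  show "{x. concurrent x S} \<subseteq> D_set \<alpha> S"
    using concurrent_mono by (auto simp: D_set_def D_triple_eq)
  show "D_set \<alpha> S \<subseteq> {x. concurrent x S}"
  proof
    fix x assume x: "x \<in> D_set \<alpha> S"
    obtain L where "L \<subseteq> S" "card L = 3" using assms by (rule obtain_subset_with_card_n)
    then obtain i j where ij: "i \<in> S" "j \<in> S" "i \<noteq> j" unfolding card_3_iff by blast
    obtain v where v: "\<alpha> i v = x $ i" "\<alpha> j v = x $ j" using ex_common_point[OF ij(3)] by blast
    \<comment> \<open>The line \<open>k\<close> passes through the meeting point of the lines
      \<open>i\<close> and \<open>j\<close> because these three form a concurrent triple.\<close>
    have "\<alpha> k v = x $ k" if k: "k \<in> S" for k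
    proof (cases "k = i \<or> k = j")
      case False
      then have "card {i, j, k} = 3" using ij by (auto simp: card_insert_if)
      then have "concurrent x {i, j, k}" using x ij k by (auto simp: D_set_def D_triple_eq)
      moreover have "concurrent x {i, j}" using v by (auto simp: concurrent_def)
      ultimately obtain w where w: "\<forall>l\<in>{i, j, k}. \<alpha> l w = x $ l" by (auto simp: concurrent_def)
      have "v = w" by (rule common_point_unique[OF ij(3)]) (use v w in auto)
      then show ?thesis using w by blast
    qed (use v in auto)
    then show "x \<in> {x. concurrent x S}" by (auto simp: concurrent_def)
  qed
qed

text \<open>Six concurrent translates are determined by their common point, so they form the image
  of the plane under a linear map. This has codimension at least 4, too much for a quadral
  point.\<close>

lemma dim_concurrent_UNIV_le: "vec.dim {x. concurrent x UNIV} \<le> 2"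
proof -
  define e where "e k = (\<chi> i. \<alpha> i (axis k 1))" for k :: 2
  have "x \<in> vec.span {e 1, e 2}" if x: "concurrent x UNIV" for x
  proof -
    obtain v where v: "\<forall>i. \<alpha> i v = x $ i" using x unfolding concurrent_def by blast
    have "x $ i = v $ 1 * \<alpha> i (axis 1 1) + v $ 2 * \<alpha> i (axis 2 1)" for i
      using v form_coordinates[of i v] by (simp add: mult.commute)
    then have "x = v $ 1 *s e 1 + v $ 2 *s e 2"
      by (simp add: vec_eq_iff e_def)
    then show ?thesis
      by (simp add: vec.span_add vec.span_base vec.span_scale)
  qed
  then have "vec.dim {x. concurrent x UNIV} \<le> card {e 1, e 2}"
    by (intro vec.dim_le_card) auto
  then show ?thesis by (simp add: card_insert_if split: if_splits)
qed

text \<open>The left-hand side is the determinant with rows \<open>(a l, b l, x $ l)\<close> for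
  \<open>l = i, j, k\<close>, expanded along its last column. The nonzero minor is that of
  \<open>i\<close> and \<open>j\<close>, whose meeting point is given by Cramer's rule.\<close>

lemma D_triple_iff:
  assumes comb: "\<And>k v. \<alpha> k v = a k * \<alpha> p v + b k * \<alpha> q v" and "p \<noteq> q"
    and "a i * b j - a j * b i \<noteq> 0"
  shows "x \<in> D_triple \<alpha> {i, j, k} \<longleftrightarrow>
    (a j * b k - a k * b j) * x $ i - (a i * b k - a k * b i) * x $ j
      + (a i * b j - a j * b i) * x $ k = 0"
proof
  assume "x \<in> D_triple \<alpha> {i, j, k}"
  then obtain v where v: "\<alpha> i v = x $ i" "\<alpha> j v = x $ j" "\<alpha> k v = x $ k"
    by (auto simp: D_triple_eq concurrent_def)
  show "(a j * b k - a k * b j) * x $ i - (a i * b k - a k * b i) * x $ j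
      + (a i * b j - a j * b i) * x $ k = 0"
    unfolding v[symmetric] comb[of i] comb[of j] comb[of k] by algebra
next
  define d where "d = a i * b j - a j * b i"
  have d: "d \<noteq> 0" using assms d_def by simp
  assume eq: "(a j * b k - a k * b j) * x $ i - (a i * b k - a k * b i) * x $ j
      + (a i * b j - a j * b i) * x $ k = 0"
  obtain v where v: "\<alpha> p v = (b j * x $ i - b i * x $ j) / d"
      "\<alpha> q v = (a i * x $ j - a j * x $ i) / d"
    using ex_common_point[OF assms(2)] by blast
  have v': "\<alpha> p v * d = b j * x $ i - b i * x $ j" "\<alpha> q v * d = a i * x $ j - a j * x $ i"
    using v d by simp_all
  have "d * \<alpha> l v = d * x $ l" if "l \<in> {i, j, k}" for l
  proof -
    have "d * \<alpha> i v = d * x $ i" "d * \<alpha> j v = d * x $ j"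
      unfolding comb[of i] comb[of j] using v' d_def by algebra+
    moreover have "d * \<alpha> k v = d * x $ k"
      unfolding comb[of k] using v' d_def eq by algebra
    ultimately show ?thesis using that by blast
  qed
  then show "x \<in> D_triple \<alpha> {i, j, k}" using d by (auto simp: D_triple_eq concurrent_def)
qed

end

subsection \<open>Hyperplane sections of a subspace\<close>

text \<open>A vector of \<open>U\<close> with nonzero value under \<open>f\<close> spans a
  complement of the section: subtracting a suitable multiple of it cancels the value of
  \<open>f\<close>.\<close>

lemma dim_Int_kernel:
  fixes f :: "'a::field ^ 'n \<Rightarrow> 'a"
  assumes U: "vec.subspace U" and f: "Vector_Spaces.linear (*s) (*) f"
    and u: "u \<in> U" "f u \<noteq> 0"
  shows "vec.dim (U \<inter> {x. f x = 0}) + 1 = vec.dim U"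
proof -
  have lin: "f (x + y) = f x + f y" "f (c *s x) = c * f x" for x y c
    using f by (simp_all add: Vector_Spaces.linear_iff)
  let ?W = "U \<inter> {x. f x = 0}"
  have W: "vec.subspace ?W"
    using U lin(2)[of 0 0] by (auto simp: vec.subspace_def lin)
  have "U = vec.span (insert u ?W)"
  proof
    show "vec.span (insert u ?W) \<subseteq> U" by (rule vec.span_minimal) (use u U in auto)
    show "U \<subseteq> vec.span (insert u ?W)"
    proof
      fix x assume x: "x \<in> U"
      define c where "c = f x / f u"
      have "x + (- c) *s u \<in> ?W"
      proof
        show "x + (- c) *s u \<in> U" by (rule vec.subspace_add[OF U x vec.subspace_scale[OF U u(1)]])
        show "x + (- c) *s u \<in> {x. f x = 0}" unfolding mem_Collect_eq lin using u by (simp add: c_def)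
      qed
      then have "x + (- c) *s u \<in> vec.span (insert u ?W)"
        by (intro vec.span_base insertI2)
      then have "(x + (- c) *s u) + c *s u \<in> vec.span (insert u ?W)"
        by (rule vec.span_add) (intro vec.span_scale vec.span_base insertI1)
      moreover have "(x + (- c) *s u) + c *s u = x" by simp
      ultimately show "x \<in> vec.span (insert u ?W)" by (simp only:)
    qed
  qed
  then have "vec.dim U = vec.dim (insert u ?W)" by (metis vec.dim_span)
  moreover have "u \<notin> vec.span ?W" using W u by (simp add: vec.span_eq_iff[THEN iffD2])
  ultimately show ?thesis by (simp add: vec.dim_insert)
qed

subsection \<open>Pasch configurations\<close>

text \<open>For distinct points, the opposite pairs are \<open>a, d\<close>, \<open>b, e\<close> and
  \<open>c, f\<close>. Each triple takes one point from each pair, with an even number of points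
  among \<open>d, e, f\<close>; the odd choices are the complements. Two points that are not
  opposite lie in exactly one triple.\<close>

definition pasch :: "'b \<Rightarrow> 'b \<Rightarrow> 'b \<Rightarrow> 'b \<Rightarrow> 'b \<Rightarrow> 'b \<Rightarrow> 'b set set" where
  "pasch a b c d e f = {{a, b, c}, {a, e, f}, {b, d, f}, {c, d, e}}"

text \<open>The reversed list gives every inequality in the other orientation, so that both are
  available as rewrite rules.\<close>

lemma labelling_distinct:
  assumes "{a, b, c, d, e, f} = (UNIV :: 6 set)"
  shows "distinct [a, b, c, d, e, f]" and "distinct [f, e, d, c, b, a]"
proof -
  have "card (set [a, b, c, d, e, f]) = CARD(6)" using assms by simp
  then show *: "distinct [a, b, c, d, e, f]" by (intro card_distinct) simp
  then have "distinct (rev [a, b, c, d, e, f])" by (simp only: distinct_rev)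
  then show "distinct [f, e, d, c, b, a]" by simp
qed

lemma labelling_all:
  assumes "{a, b, c, d, e, f} = (UNIV :: 6 set)"
  shows "(\<forall>x. P x) \<longleftrightarrow> P a \<and> P b \<and> P c \<and> P d \<and> P e \<and> P f"
  using assms by (metis UNIV_I empty_iff insert_iff)

text \<open>
  Permuting the three opposite pairs, or exchanging the elements of two of them, does not change
  the configuration. With the composites, ordered rewriting has only two normal forms.
\<close>

lemma pasch_symmetries:
  "pasch b a c e d f = pasch a b c d e f"
  "pasch a c b d f e = pasch a b c d e f"
  "pasch c b a f e d = pasch a b c d e f"
  "pasch a e f d b c = pasch a b c d e f"
  "pasch d b f a e c = pasch a b c d e f"
  "pasch d e c a b f = pasch a b c d e f"
  "pasch a f e d c b = pasch a b c d e f"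
  "pasch f b d c e a = pasch a b c d e f"
  "pasch e d c b a f = pasch a b c d e f"
  by (auto simp: pasch_def)

lemma pasch_complement:
  assumes lab: "{a, b, c, d, e, f} = (UNIV :: 6 set)"
  shows "(\<lambda>L. - L) ` pasch a b c d e f = pasch d e f a b c"
proof -
  note dist = labelling_distinct[OF lab]
  have "- {a, b, c} = {d, e, f}" "- {a, e, f} = {d, b, c}" "- {b, d, f} = {e, a, c}"
    "- {c, d, e} = {f, a, b}"
    using dist by (simp_all add: set_eq_iff labelling_all[OF lab])
  then show ?thesis by (simp add: pasch_def)
qed

text \<open>Complementing all triples amounts to exchanging the points of every opposite pair, which
  leaves the permutation unchanged. So relabelling absorbs the choice between a 4-set and its
  complement.\<close>

lemma corresponding_iff:
  "corresponding \<sigma> T \<longleftrightarrow>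
     (\<exists>a b c d e f. {a, b, c, d, e, f} = UNIV \<and>
        \<sigma> = \<langle>a \<leftrightarrow> d\<rangle> * \<langle>b \<leftrightarrow> e\<rangle> * \<langle>c \<leftrightarrow> f\<rangle> \<and> T = pasch a b c d e f)" (is "_ \<longleftrightarrow> ?R")
proof
  assume "corresponding \<sigma> T"
  then obtain a b c d e f where lab: "{a, b, c, d, e, f} = UNIV"
    and \<sigma>: "\<sigma> = \<langle>a \<leftrightarrow> d\<rangle> * \<langle>b \<leftrightarrow> e\<rangle> * \<langle>c \<leftrightarrow> f\<rangle>"
    and T: "T = pasch a b c d e f \<or> T = (\<lambda>L. - L) ` pasch a b c d e f"
    unfolding corresponding_def Let_def pasch_def[symmetric] by (elim exE conjE) (rule that)
  have lab': "{d, e, f, a, b, c} = UNIV" using lab by auto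
  have "\<sigma> = \<langle>d \<leftrightarrow> a\<rangle> * \<langle>e \<leftrightarrow> b\<rangle> * \<langle>f \<leftrightarrow> c\<rangle>" unfolding \<sigma> by (simp only: swap_sym)
  then show ?R using T unfolding pasch_complement[OF lab]
  proof (elim disjE)
    assume "T = pasch a b c d e f"
    then show ?R using lab \<sigma> by (intro exI conjI)
  next
    assume "T = pasch d e f a b c" "\<sigma> = \<langle>d \<leftrightarrow> a\<rangle> * \<langle>e \<leftrightarrow> b\<rangle> * \<langle>f \<leftrightarrow> c\<rangle>"
    then show ?R using lab' by (intro exI conjI)
  qed
next
  assume ?R
  then show "corresponding \<sigma> T"
    unfolding corresponding_def Let_def pasch_def[symmetric]
    by (elim exE conjE) (intro exI conjI disjI1)
qed

lemma corresponding_cases: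
  assumes "corresponding \<sigma> T"
  obtains a b c d e f where "{a, b, c, d, e, f} = (UNIV :: 6 set)"
    "\<sigma> = \<langle>a \<leftrightarrow> d\<rangle> * \<langle>b \<leftrightarrow> e\<rangle> * \<langle>c \<leftrightarrow> f\<rangle>" "T = pasch a b c d e f"
  using assms unfolding corresponding_iff by (elim exE conjE)

lemma card_pasch:
  assumes "corresponding \<sigma> T"
  shows "card T = 4" and "L \<in> T \<Longrightarrow> card L = 3"
proof -
  obtain a b c d e f where lab: "{a, b, c, d, e, f} = (UNIV :: 6 set)" and T: "T = pasch a b c d e f"
    using assms unfolding corresponding_iff by blast
  note dist = labelling_distinct[OF lab]
  have neqI: "A \<noteq> B" if "x \<in> A" "x \<notin> B" for A B :: "6 set" and x
    using that by blast
  have "{a, b, c} \<noteq> {a, e, f}" by (rule neqI[of b]) (use dist in simp_all)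
  moreover have "{a, b, c} \<noteq> {b, d, f}" by (rule neqI[of a]) (use dist in simp_all)
  moreover have "{a, b, c} \<noteq> {c, d, e}" by (rule neqI[of a]) (use dist in simp_all)
  moreover have "{a, e, f} \<noteq> {b, d, f}" by (rule neqI[of a]) (use dist in simp_all)
  moreover have "{a, e, f} \<noteq> {c, d, e}" by (rule neqI[of a]) (use dist in simp_all)
  moreover have "{b, d, f} \<noteq> {c, d, e}" by (rule neqI[of b]) (use dist in simp_all)
  ultimately show "card T = 4" unfolding T pasch_def
    by (simp only: card_insert_if finite.intros insert_iff empty_iff simp_thms if_False card.empty)
  show "L \<in> T \<Longrightarrow> card L = 3" unfolding T pasch_def using dist by (auto simp: card_insert_if)
qed

text \<open>The two triples through \<open>u\<close> meet only in \<open>u\<close>, so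
  \<open>w\<close> lies on at most one of them.\<close>

lemma pasch_separates:
  assumes "corresponding \<sigma> T" and "u \<noteq> w"
  shows "\<exists>L\<in>T. u \<in> L \<and> w \<notin> L"
proof -
  obtain a b c d e f where lab: "{a, b, c, d, e, f} = (UNIV :: 6 set)" and T: "T = pasch a b c d e f"
    using assms(1) by (rule corresponding_cases) blast
  have "\<forall>u w. u \<noteq> w \<longrightarrow> (\<exists>L\<in>pasch a b c d e f. u \<in> L \<and> w \<notin> L)"
    using labelling_distinct[OF lab] by (simp add: labelling_all[OF lab] pasch_def)
  then show ?thesis using assms(2) T by blast
qed

text \<open>At most one point other than \<open>u\<close> is missing from \<open>S\<close>, and a
  triple through \<open>u\<close> that avoids it has its other two points in \<open>S\<close>. This
  is how concurrency spreads from the lines of \<open>S\<close> to the line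
  \<open>u\<close>.\<close>

lemma pasch_covers_outside:
  assumes T: "corresponding \<sigma> T" and S: "card S \<ge> 4" "u \<notin> S"
  shows "\<exists>L\<in>T. u \<in> L \<and> L - {u} \<subseteq> S"
proof -
  have "card (UNIV :: 6 set) - card S \<le> 2" using S by simp
  then have "card (- S - {u}) \<le> 1"
    using S by (simp add: Compl_eq_Diff_UNIV card_Diff_subset)
  then have "\<forall>v\<in>- S - {u}. \<forall>w\<in>- S - {u}. v = w" by (simp add: card_le_Suc0_iff_eq)
  then obtain w where w: "- S - {u} \<subseteq> {w}" by blast
  \<comment> \<open>Only when no point besides \<open>u\<close> is missing can \<open>w\<close> be
    \<open>u\<close>, and then any other point will do.\<close>
  obtain w' where "w' \<noteq> u" "- S - {u} \<subseteq> {w'}"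
  proof (cases "w = u")
    case True
    have "\<exists>w' :: 6. w' \<noteq> u" by (metis neq6(1))
    then show ?thesis using that w True by blast
  qed (use that w in blast)
  then show ?thesis using pasch_separates[OF T, of u w'] by blast
qed

lemma syntheme_apply:
  assumes lab: "{a, b, c, d, e, f} = (UNIV :: 6 set)"
  shows "(\<langle>a \<leftrightarrow> d\<rangle> * \<langle>b \<leftrightarrow> e\<rangle> * \<langle>c \<leftrightarrow> f\<rangle>) \<langle>$\<rangle> a = d" "(\<langle>a \<leftrightarrow> d\<rangle> * \<langle>b \<leftrightarrow> e\<rangle> * \<langle>c \<leftrightarrow> f\<rangle>) \<langle>$\<rangle> b = e"
    "(\<langle>a \<leftrightarrow> d\<rangle> * \<langle>b \<leftrightarrow> e\<rangle> * \<langle>c \<leftrightarrow> f\<rangle>) \<langle>$\<rangle> c = f" "(\<langle>a \<leftrightarrow> d\<rangle> * \<langle>b \<leftrightarrow> e\<rangle> * \<langle>c \<leftrightarrow> f\<rangle>) \<langle>$\<rangle> d = a"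
    "(\<langle>a \<leftrightarrow> d\<rangle> * \<langle>b \<leftrightarrow> e\<rangle> * \<langle>c \<leftrightarrow> f\<rangle>) \<langle>$\<rangle> e = b" "(\<langle>a \<leftrightarrow> d\<rangle> * \<langle>b \<leftrightarrow> e\<rangle> * \<langle>c \<leftrightarrow> f\<rangle>) \<langle>$\<rangle> f = c"
  using labelling_distinct[OF lab] by (simp_all add: apply_times apply_swap_same)

text \<open>The pairs covered by no triple of a Pasch configuration are the opposite ones, which
  \<open>\<sigma>\<close> exchanges; this recovers \<open>\<sigma>\<close> from
  \<open>T\<close>.\<close>

lemma corresponding_apply:
  assumes "corresponding \<sigma> T"
  shows "\<sigma> \<langle>$\<rangle> x = y \<longleftrightarrow> x \<noteq> y \<and> (\<forall>L\<in>T. \<not> (x \<in> L \<and> y \<in> L))"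
proof -
  obtain a b c d e f where lab: "{a, b, c, d, e, f} = (UNIV :: 6 set)" and T: "T = pasch a b c d e f"
    and \<sigma>: "\<sigma> = \<langle>a \<leftrightarrow> d\<rangle> * \<langle>b \<leftrightarrow> e\<rangle> * \<langle>c \<leftrightarrow> f\<rangle>"
    using assms(1) by (rule corresponding_cases) blast
  note dist = labelling_distinct[OF lab]
  have "\<forall>x y. \<sigma> \<langle>$\<rangle> x = y \<longleftrightarrow> x \<noteq> y \<and> (\<forall>L\<in>pasch a b c d e f. \<not> (x \<in> L \<and> y \<in> L))"
    using syntheme_apply[OF lab, folded \<sigma>] dist by (simp add: labelling_all[OF lab] pasch_def)
  then show ?thesis unfolding T by blast
qed

text \<open>A point has only one opposite, so it shares a triple of \<open>T\<close> with at least
  one of the other two points of \<open>K\<close>.\<close>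

lemma pasch_meets_triple:
  assumes "corresponding \<sigma> T" and "card K = 3"
  shows "\<exists>L\<in>T. \<exists>x y. x \<noteq> y \<and> x \<in> K \<and> y \<in> K \<and> x \<in> L \<and> y \<in> L"
proof -
  obtain x y z where "K = {x, y, z}" "x \<noteq> y" "x \<noteq> z" "y \<noteq> z"
    using assms(2) unfolding card_3_iff by blast
  then show ?thesis
    using corresponding_apply[OF assms(1), of x y] corresponding_apply[OF assms(1), of x z] by blast
qed

lemma corresponding_unique:
 assumes "corresponding \<sigma> T" "corresponding \<tau> T" shows "\<sigma> = \<tau>"
proof (rule perm_eqI)
  fix x
  have "\<tau> \<langle>$\<rangle> x = \<tau> \<langle>$\<rangle> x" by (rule refl)
  then show "\<sigma> \<langle>$\<rangle> x = \<tau> \<langle>$\<rangle> x"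
    unfolding corresponding_apply[OF assms(1)] by (subst (asm) corresponding_apply[OF assms(2)])
qed

text \<open>A labelling for \<open>\<sigma>\<close> orders the three transpositions and picks a
  first point in each. The order does not affect the configuration and the picks matter only up to
  parity, which leaves two configurations.\<close>

lemma card_corresponding:
  assumes "corresponding \<sigma> T"
  shows "card {T. corresponding \<sigma> T} = 2"
proof -
  obtain a b c d e f where lab: "{a, b, c, d, e, f} = (UNIV :: 6 set)"
    and \<sigma>: "\<sigma> = \<langle>a \<leftrightarrow> d\<rangle> * \<langle>b \<leftrightarrow> e\<rangle> * \<langle>c \<leftrightarrow> f\<rangle>"
    using assms(1) by (rule corresponding_cases) blast
  note dist = labelling_distinct[OF lab]
  have lab': "{d, e, f, a, b, c} = UNIV" using lab by auto
  have "\<sigma> = \<langle>d \<leftrightarrow> a\<rangle> * \<langle>e \<leftrightarrow> b\<rangle> * \<langle>f \<leftrightarrow> c\<rangle>" unfolding \<sigma> by (simp only: swap_sym)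
  then have cor: "corresponding \<sigma> (pasch a b c d e f)" "corresponding \<sigma> (pasch d e f a b c)"
    unfolding corresponding_iff using lab lab' \<sigma> by blast+
  \<comment> \<open>The 48 ordered choices of one point from each transposition are checked by
    rewriting with \<open>pasch_symmetries\<close>.\<close>
  have rel: "\<forall>p q r. p \<noteq> q \<longrightarrow> p \<noteq> r \<longrightarrow> q \<noteq> r \<longrightarrow>
      q \<noteq> \<sigma> \<langle>$\<rangle> p \<longrightarrow> r \<noteq> \<sigma> \<langle>$\<rangle> p \<longrightarrow> r \<noteq> \<sigma> \<langle>$\<rangle> q \<longrightarrow>
      pasch p q r (\<sigma> \<langle>$\<rangle> p) (\<sigma> \<langle>$\<rangle> q) (\<sigma> \<langle>$\<rangle> r) = pasch a b c d e f \<or>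
      pasch p q r (\<sigma> \<langle>$\<rangle> p) (\<sigma> \<langle>$\<rangle> q) (\<sigma> \<langle>$\<rangle> r) = pasch d e f a b c"
    by (simp only: labelling_all[OF lab] syntheme_apply[OF lab, folded \<sigma>]
        not_True_eq_False simp_thms)
      (simp only: pasch_symmetries simp_thms)
  have sub: "T' \<in> {pasch a b c d e f, pasch d e f a b c}" if cor': "corresponding \<sigma> T'" for T'
  proof -
    obtain p q r p' q' r' where lab': "{p, q, r, p', q', r'} = (UNIV :: 6 set)"
      and \<sigma>': "\<sigma> = \<langle>p \<leftrightarrow> p'\<rangle> * \<langle>q \<leftrightarrow> q'\<rangle> * \<langle>r \<leftrightarrow> r'\<rangle>" and T': "T' = pasch p q r p' q' r'"
      using cor' by (rule corresponding_cases)
    note dist' = labelling_distinct[OF lab']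
    have "p' = \<sigma> \<langle>$\<rangle> p" "q' = \<sigma> \<langle>$\<rangle> q" "r' = \<sigma> \<langle>$\<rangle> r"
      using syntheme_apply[OF lab', folded \<sigma>'] by auto
    then have "T' = pasch p q r (\<sigma> \<langle>$\<rangle> p) (\<sigma> \<langle>$\<rangle> q) (\<sigma> \<langle>$\<rangle> r)"
      and "p \<noteq> q" "p \<noteq> r" "q \<noteq> r" "q \<noteq> \<sigma> \<langle>$\<rangle> p" "r \<noteq> \<sigma> \<langle>$\<rangle> p" "r \<noteq> \<sigma> \<langle>$\<rangle> q"
      using T' dist' by simp_all
    then show ?thesis using rel by (simp only: insert_iff empty_iff simp_thms)
  qed
  have pair: "{T. corresponding \<sigma> T} = {pasch a b c d e f, pasch d e f a b c}"
  proof (intro equalityI subsetI)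
    show "T' \<in> {pasch a b c d e f, pasch d e f a b c}" if "T' \<in> {T. corresponding \<sigma> T}" for T'
      using that by (intro sub) (simp only: mem_Collect_eq)
    show "T' \<in> {T. corresponding \<sigma> T}" if "T' \<in> {pasch a b c d e f, pasch d e f a b c}" for T'
      using that by (elim insertE emptyE) (simp_all only: mem_Collect_eq cor)
  qed
  have "{a, b, c} \<notin> pasch d e f a b c" using dist by (auto simp: pasch_def set_eq_iff)
  moreover have "{a, b, c} \<in> pasch a b c d e f" by (simp add: pasch_def)
  ultimately have "pasch a b c d e f \<noteq> pasch d e f a b c" by metis
  then show ?thesis unfolding pair by simp
qed

section \<open>Recognizing Pasch configurations by pairwise intersections\<close>

lemma third_triple:
  assumes lab: "{a, b, c, d, e, f} = (UNIV :: 6 set)" and L: "card L = 3"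
    and abc: "\<And>x y. x \<noteq> y \<Longrightarrow> x \<in> {a, b, c} \<Longrightarrow> y \<in> {a, b, c} \<Longrightarrow> \<not> (x \<in> L \<and> y \<in> L)"
    and aef: "\<And>x y. x \<noteq> y \<Longrightarrow> x \<in> {a, e, f} \<Longrightarrow> y \<in> {a, e, f} \<Longrightarrow> \<not> (x \<in> L \<and> y \<in> L)"
  shows "L \<in> {{b, d, f}, {c, d, e}, {b, d, e}, {c, d, f}}"
proof -
  note dist = labelling_distinct[OF lab]
  have le: "card (L \<inter> {a, b, c}) \<le> 1" "card (L \<inter> {e, f}) \<le> 1"
    using abc aef by (auto simp: card_le_Suc0_iff_eq simp del: Int_insert_right)
  have split: "L = (L \<inter> {a, b, c}) \<union> (L \<inter> {e, f}) \<union> (L \<inter> {d})" using lab by blast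
  then have "3 \<le> card (L \<inter> {a, b, c}) + card (L \<inter> {e, f}) + card (L \<inter> {d})"
    using L card_Un_le[of "L \<inter> {a, b, c} \<union> L \<inter> {e, f}" "L \<inter> {d}"]
      card_Un_le[of "L \<inter> {a, b, c}" "L \<inter> {e, f}"] by simp
  moreover have "card (L \<inter> {d}) \<le> 1" using card_mono[of "{d}" "L \<inter> {d}"] by simp
  \<comment> \<open>Each of the three parts holds at most one point of \<open>L\<close>, and
    together they hold all three.\<close>
  ultimately have "card (L \<inter> {a, b, c}) = 1" "card (L \<inter> {e, f}) = 1" "card (L \<inter> {d}) = 1"
    using le by linarith+
  then obtain p q r where pqr: "L \<inter> {a, b, c} = {p}" "L \<inter> {e, f} = {q}" "L \<inter> {d} = {r}"
    by (meson card_1_singletonE)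
  have "r = d" using pqr by blast
  have "L = {p} \<union> {q} \<union> {r}" by (rule trans[OF split]) (simp only: pqr)
  then have Leq: "L = {p, d, q}" using \<open>r = d\<close> by blast
  \<comment> \<open>Otherwise \<open>L\<close> would share both \<open>a\<close> and
    \<open>q\<close> with \<open>{a, e, f}\<close>.\<close>
  have "p \<noteq> a" using aef[of a q] pqr dist by auto
  then have "p = b \<or> p = c" "q = e \<or> q = f" using pqr by blast+
  then show ?thesis unfolding Leq by (elim disjE) (simp_all add: insert_commute)
qed

text \<open>Two triples through a common point \<open>a\<close> name five points, and the sixth is
  \<open>d\<close>. The remaining two triples both contain \<open>d\<close>, which determines the
  configuration up to exchanging \<open>e\<close> and \<open>f\<close>.\<close>

lemma ex_pasch:
  fixes T :: "6 set set"
  assumes T: "card T = 4" "\<And>L. L \<in> T \<Longrightarrow> card L = 3"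
    and meet: "\<And>L L' x y. L \<in> T \<Longrightarrow> L' \<in> T \<Longrightarrow> L \<noteq> L' \<Longrightarrow> x \<noteq> y \<Longrightarrow>
      x \<in> L \<Longrightarrow> y \<in> L \<Longrightarrow> x \<in> L' \<Longrightarrow> y \<in> L' \<Longrightarrow> False"
  shows "\<exists>\<sigma>. corresponding \<sigma> T"
proof -
  obtain L1 T3 where L1: "T = insert L1 T3" "L1 \<notin> T3" "card T3 = 3"
    using T(1) card_Suc_eq[of T 3] by auto
  obtain L2 L3 L4 where L234: "T3 = {L2, L3, L4}" "L2 \<noteq> L3" "L2 \<noteq> L4" "L3 \<noteq> L4"
    using L1(3) unfolding card_3_iff by blast
  have Teq: "T = {L1, L2, L3, L4}" and ne: "L1 \<noteq> L2" "L1 \<noteq> L3" "L1 \<noteq> L4"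
    using L1 L234 by auto
  have "L1 \<inter> L2 \<noteq> {}"
  proof
    \<comment> \<open>Disjoint triples would cover all six points, so two of the three points of
      \<open>L3\<close> would lie in the same one.\<close>
    assume disj: "L1 \<inter> L2 = {}"
    have "card (L1 \<union> L2) = CARD(6)"
      using T(2)[of L1] T(2)[of L2] disj by (simp add: card_Un_disjoint Teq)
    then have "L1 \<union> L2 = UNIV" by (intro card_subset_eq) auto
    then have cover: "v \<in> L1 \<or> v \<in> L2" for v by blast
    obtain x y z where L3: "L3 = {x, y, z}" "x \<noteq> y" "x \<noteq> z" "y \<noteq> z"
      using T(2)[of L3] Teq unfolding card_3_iff by blast
    have "\<not> (u \<in> L \<and> v \<in> L)" if "u \<noteq> v" "u \<in> L3" "v \<in> L3" "L \<in> {L1, L2}" for L u v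
      using meet[of L L3 u v] that Teq ne L234 by blast
    then have "\<not> (x \<in> L \<and> y \<in> L)" "\<not> (x \<in> L \<and> z \<in> L)" "\<not> (y \<in> L \<and> z \<in> L)" if "L \<in> {L1, L2}" for L
      using that L3 by simp_all
    from this[of L1] this[of L2] show False
      using cover[of x] cover[of y] cover[of z] by blast
  qed
  then obtain a where a: "a \<in> L1" "a \<in> L2" by blast
  have two: "\<exists>x y. L = {a, x, y} \<and> x \<noteq> a \<and> y \<noteq> a \<and> x \<noteq> y" if "card L = 3" "a \<in> L" for L
  proof -
    have "card (L - {a}) = 2" using that by simp
    then obtain x y where "L - {a} = {x, y}" "x \<noteq> y" unfolding card_2_iff by blast
    then show ?thesis using that by blast
  qed
  obtain b c where bc: "L1 = {a, b, c}" "b \<noteq> a" "c \<noteq> a" "b \<noteq> c"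
    using two[of L1] T(2) a Teq by blast
  obtain e f where ef: "L2 = {a, e, f}" "e \<noteq> a" "f \<noteq> a" "e \<noteq> f"
    using two[of L2] T(2) a Teq by blast
  have "x \<notin> L2" if "x \<in> {b, c}" for x
    using meet[of L1 L2 a x] that a Teq ne bc by blast
  then have ne5: "b \<noteq> e" "b \<noteq> f" "c \<noteq> e" "c \<noteq> f" using ef by auto
  have "{a, b, c, e, f} \<noteq> UNIV"
  proof
    assume "{a, b, c, e, f} = UNIV"
    then have "card {a, b, c, e, f} = CARD(6)" by simp
    then show False using card_length[of "[a, b, c, e, f]"] by simp
  qed
  then obtain d where d: "d \<notin> {a, b, c, e, f}" by blast
  have "card {a, b, c, d, e, f} = CARD(6)" using d bc ef ne5 by (auto simp: card_insert_if)
  then have lab: "{a, b, c, d, e, f} = UNIV" by (intro card_subset_eq) auto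
  have in4: "L \<in> {{b, d, f}, {c, d, e}, {b, d, e}, {c, d, f}}" if L: "L \<in> {L3, L4}" for L
  proof (rule third_triple[OF lab])
    show "card L = 3" using T(2) L Teq by blast
    show "\<not> (x \<in> L \<and> y \<in> L)" if "x \<noteq> y" "x \<in> {a, b, c}" "y \<in> {a, b, c}" for x y
      using meet[of L1 L x y] that L Teq ne bc by blast
    show "\<not> (x \<in> L \<and> y \<in> L)" if "x \<noteq> y" "x \<in> {a, e, f}" "y \<in> {a, e, f}" for x y
      using meet[of L2 L x y] that L Teq L234 ef by blast
  qed
  have d34: "d \<in> L3" "d \<in> L4" using in4 by auto
  have opp: "\<not> (x \<in> L3 \<and> x \<in> L4)" if "x \<noteq> d" for x
    using meet[of L3 L4 d x] that d34 Teq L234 by blast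
  \<comment> \<open>Apart from \<open>d\<close> the two triples are disjoint, so they split
    \<open>b, c\<close> and \<open>e, f\<close> between them. Up to their order this can be done in
    two ways.\<close>
  have "L3 = {b, d, f} \<and> L4 = {c, d, e} \<or> L3 = {c, d, e} \<and> L4 = {b, d, f} \<or>
      L3 = {b, d, e} \<and> L4 = {c, d, f} \<or> L3 = {c, d, f} \<and> L4 = {b, d, e}"
  proof -
    have "\<not> (b \<in> L3 \<and> b \<in> L4)" "\<not> (c \<in> L3 \<and> c \<in> L4)" "\<not> (e \<in> L3 \<and> e \<in> L4)" "\<not> (f \<in> L3 \<and> f \<in> L4)"
      using opp labelling_distinct[OF lab] by simp_all
    moreover have "L3 = {b, d, f} \<or> L3 = {c, d, e} \<or> L3 = {b, d, e} \<or> L3 = {c, d, f}"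
      "L4 = {b, d, f} \<or> L4 = {c, d, e} \<or> L4 = {b, d, e} \<or> L4 = {c, d, f}"
      using in4[of L3] in4[of L4] by (simp_all only: insert_iff empty_iff simp_thms)
    ultimately show ?thesis
      by (elim disjE) (iprover | (simp only: insert_iff simp_thms))+
  qed
  then have "T = pasch a b c d e f \<or> T = pasch a b c d f e"
    unfolding Teq bc ef pasch_def by (elim disjE conjE) (simp_all add: insert_commute)
  moreover have "{a, b, c, d, f, e} = UNIV" using lab by auto
  ultimately show ?thesis unfolding corresponding_iff using lab by blast
qed

subsection \<open>Synthemes as images of transpositions\<close>

text \<open>Conjugation relabels a transposition; writing it as a commutation rule avoids
  inverses.\<close>

lemma perm_times_swap: "g * \<langle>a \<leftrightarrow> b\<rangle> = \<langle>g \<langle>$\<rangle> a \<leftrightarrow> g \<langle>$\<rangle> b\<rangle> * g"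
  by (rule perm_eqI) (auto simp: apply_times swap.rep_eq Transposition.transpose_def apply_inj)

lemma perm_times_syntheme:
  "g * (\<langle>a \<leftrightarrow> d\<rangle> * \<langle>b \<leftrightarrow> e\<rangle> * \<langle>c \<leftrightarrow> f\<rangle>) =
    \<langle>g \<langle>$\<rangle> a \<leftrightarrow> g \<langle>$\<rangle> d\<rangle> * \<langle>g \<langle>$\<rangle> b \<leftrightarrow> g \<langle>$\<rangle> e\<rangle> * \<langle>g \<langle>$\<rangle> c \<leftrightarrow> g \<langle>$\<rangle> f\<rangle> * g"
proof -
  have "g * (\<langle>a \<leftrightarrow> d\<rangle> * \<langle>b \<leftrightarrow> e\<rangle> * \<langle>c \<leftrightarrow> f\<rangle>) = g * \<langle>a \<leftrightarrow> d\<rangle> * \<langle>b \<leftrightarrow> e\<rangle> * \<langle>c \<leftrightarrow> f\<rangle>"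
    by (simp only: mult.assoc)
  then show ?thesis by (metis perm_times_swap mult.assoc)
qed

lemma ex_perm_labelling:
  assumes lab: "{a, b, c, d, e, f} = (UNIV :: 6 set)"
  shows "\<exists>g. g \<langle>$\<rangle> 1 = a \<and> g \<langle>$\<rangle> 2 = b \<and> g \<langle>$\<rangle> 3 = c \<and> g \<langle>$\<rangle> 4 = d \<and> g \<langle>$\<rangle> 5 = e \<and> g \<langle>$\<rangle> 6 = f"
proof -
  define h where "h k = (if k = 1 then a else if k = 2 then b else if k = 3 then c
    else if k = 4 then d else if k = 5 then e else f)" for k :: 6
  have h: "h 1 = a" "h 2 = b" "h 3 = c" "h 4 = d" "h 5 = e" "h 6 = f"
    by (simp_all only: h_def neq6 if_False if_True refl)
  have "range h = UNIV" unfolding UNIV_6 image_insert image_empty h using lab UNIV_6 by simp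
  then have "bij h" by (simp add: bij_def finite_UNIV_surj_inj)
  then have "Perm h \<langle>$\<rangle> k = h k" for k by (simp add: Perm_inverse)
  then show ?thesis using h by metis
qed

lemma outer_phi_mult: "outer_phi (\<sigma> * \<tau>) = outer_phi \<sigma> * outer_phi \<tau>"
  using is_outer_phi_outer_phi by (simp add: is_outer_phi_def)

lemma bij_outer_phi: "bij outer_phi"
  using is_outer_phi_outer_phi by (simp add: is_outer_phi_def)

lemma outer_phi_12: "outer_phi \<langle>1 \<leftrightarrow> 2\<rangle> = \<langle>1 \<leftrightarrow> 5\<rangle> * \<langle>2 \<leftrightarrow> 6\<rangle> * \<langle>3 \<leftrightarrow> 4\<rangle>"
  using is_outer_phi_outer_phi unfolding is_outer_phi_def by blast

text \<open>Conjugation by \<open>h\<close> becomes conjugation by \<open>g\<close> under the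
  automorphism, which transports the value at \<open>\<langle>1 \<leftrightarrow> 2\<rangle>\<close>
  to every transposition.\<close>

lemma outer_phi_swap:
  assumes g: "g = outer_phi h"
  shows "outer_phi \<langle>h \<langle>$\<rangle> 1 \<leftrightarrow> h \<langle>$\<rangle> 2\<rangle> =
    \<langle>g \<langle>$\<rangle> 1 \<leftrightarrow> g \<langle>$\<rangle> 5\<rangle> * \<langle>g \<langle>$\<rangle> 2 \<leftrightarrow> g \<langle>$\<rangle> 6\<rangle> * \<langle>g \<langle>$\<rangle> 3 \<leftrightarrow> g \<langle>$\<rangle> 4\<rangle>"
proof -
  have "outer_phi \<langle>h \<langle>$\<rangle> 1 \<leftrightarrow> h \<langle>$\<rangle> 2\<rangle> * g = g * outer_phi \<langle>1 \<leftrightarrow> 2\<rangle>"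
    unfolding g by (simp only: perm_times_swap flip: outer_phi_mult)
  also have "\<dots> = \<langle>g \<langle>$\<rangle> 1 \<leftrightarrow> g \<langle>$\<rangle> 5\<rangle> * \<langle>g \<langle>$\<rangle> 2 \<leftrightarrow> g \<langle>$\<rangle> 6\<rangle> * \<langle>g \<langle>$\<rangle> 3 \<leftrightarrow> g \<langle>$\<rangle> 4\<rangle> * g"
    unfolding outer_phi_12 by (rule perm_times_syntheme)
  finally show ?thesis by (simp only: perm.right_cancel)
qed

lemma ex_corresponding_outer_phi:
  assumes "i \<noteq> j"
  shows "\<exists>T. corresponding (outer_phi \<langle>i \<leftrightarrow> j\<rangle>) T"
proof -
  \<comment> \<open>The swap with \<open>i\<close> sends 1 to \<open>i\<close> and 2 to
    \<open>k\<close>; the second swap then moves \<open>k\<close> to \<open>j\<close> and leaves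
    \<open>i\<close> in place.\<close>
  define k where "k = \<langle>1 \<leftrightarrow> i\<rangle> \<langle>$\<rangle> 2"
  define h where "h = \<langle>k \<leftrightarrow> j\<rangle> * \<langle>1 \<leftrightarrow> i\<rangle>"
  have "k \<noteq> i" unfolding k_def by (metis apply_inj apply_swap_simp(1) neq6(1))
  then have h: "h \<langle>$\<rangle> 1 = i" "h \<langle>$\<rangle> 2 = j"
    using assms by (simp_all add: h_def apply_times flip: k_def)
  define g where "g = outer_phi h"
  have "(\<langle>$\<rangle>) g ` {1, 2, 3, 4, 5, 6} = UNIV"
    unfolding UNIV_6[symmetric] by (rule bij_is_surj[OF bij_apply])
  \<comment> \<open>In this order the opposite pairs are the images of 1, 5 and 2, 6 and 3, 4, the
    pairs exchanged by \<open>outer_phi \<langle>1 \<leftrightarrow> 2\<rangle>\<close>.\<close>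
  then have lab: "{g \<langle>$\<rangle> 1, g \<langle>$\<rangle> 2, g \<langle>$\<rangle> 3, g \<langle>$\<rangle> 5, g \<langle>$\<rangle> 6, g \<langle>$\<rangle> 4} = UNIV"
    by (simp only: image_insert image_empty insert_commute)
  show ?thesis
    unfolding corresponding_iff
    by (intro exI conjI) (rule lab, rule outer_phi_swap[OF g_def, unfolded h], rule refl)
qed

text \<open>All synthemes are conjugate, so some \<open>g\<close> carries
  \<open>outer_phi \<langle>1 \<leftrightarrow> 2\<rangle>\<close> to \<open>\<sigma>\<close>; a
  preimage of \<open>g\<close> carries \<open>\<langle>1 \<leftrightarrow> 2\<rangle>\<close> to the
  required transposition.\<close>

lemma corresponding_ex_outer_phi:
  assumes "corresponding \<sigma> T"
  shows "\<exists>i j. i \<noteq> j \<and> \<sigma> = outer_phi \<langle>i \<leftrightarrow> j\<rangle>"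
proof -
  obtain a b c d e f where lab: "{a, b, c, d, e, f} = (UNIV :: 6 set)"
    and \<sigma>: "\<sigma> = \<langle>a \<leftrightarrow> d\<rangle> * \<langle>b \<leftrightarrow> e\<rangle> * \<langle>c \<leftrightarrow> f\<rangle>"
    using assms(1) by (rule corresponding_cases) blast
  have "{a, b, c, f, d, e} = UNIV" using lab by auto
  then obtain g where g: "g \<langle>$\<rangle> 1 = a" "g \<langle>$\<rangle> 2 = b" "g \<langle>$\<rangle> 3 = c" "g \<langle>$\<rangle> 4 = f" "g \<langle>$\<rangle> 5 = d" "g \<langle>$\<rangle> 6 = e"
    using ex_perm_labelling by metis
  obtain h where "g = outer_phi h" using bij_outer_phi by (metis bij_pointE)
  then have "outer_phi \<langle>h \<langle>$\<rangle> 1 \<leftrightarrow> h \<langle>$\<rangle> 2\<rangle> = \<sigma>" using outer_phi_swap g unfolding \<sigma> by metis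
  moreover have "h \<langle>$\<rangle> 1 \<noteq> h \<langle>$\<rangle> 2" by (simp add: apply_inj)
  ultimately show ?thesis by metis
qed

context generic_lines
begin

subsection \<open>Permutations induced by projectivities\<close>

text \<open>Linearity and bijectivity of \<open>M\<close> are implied: two of the forms are
  coordinates of the plane, and the factors \<open>c i\<close> are nonzero. So \<open>M\<close> maps
  the kernel of \<open>\<alpha> (\<sigma> \<langle>$\<rangle> i)\<close> onto that of
  \<open>\<alpha> i\<close>.\<close>

definition realized :: "6 perm \<Rightarrow> bool" where
  "realized \<sigma> \<longleftrightarrow> (\<exists>M c. (\<forall>i. c i \<noteq> 0) \<and> (\<forall>i v. \<alpha> i (M v) = c i * \<alpha> (\<sigma> \<langle>$\<rangle> i) v))"

lemma realized_one: "realized 1"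
  unfolding realized_def by (intro exI[of _ "\<lambda>v. v"] exI[of _ "\<lambda>i. 1"]) simp

text \<open>Pulling back forms reverses the order of composition.\<close>

lemma realized_mult:
  assumes "realized \<sigma>" "realized \<tau>"
  shows "realized (\<tau> * \<sigma>)"
proof -
  obtain M c where M: "\<forall>i. c i \<noteq> 0" "\<forall>i v. \<alpha> i (M v) = c i * \<alpha> (\<sigma> \<langle>$\<rangle> i) v"
    using assms(1) unfolding realized_def by blast
  obtain N d where N: "\<forall>i. d i \<noteq> 0" "\<forall>i v. \<alpha> i (N v) = d i * \<alpha> (\<tau> \<langle>$\<rangle> i) v"
    using assms(2) unfolding realized_def by blast
  show ?thesis
    unfolding realized_def
    by (intro exI[of _ "\<lambda>v. M (N v)"] exI[of _ "\<lambda>i. c i * d (\<sigma> \<langle>$\<rangle> i)"])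
      (simp add: M N apply_times)
qed

text \<open>Since \<open>M\<close> exchanges the coordinates up to factors \<open>s a\<close> and
  \<open>s d\<close>, it is antidiagonal. Exchanging \<open>b, e\<close> forces
  \<open>s d : s a = p b * p e : q b * q e\<close>, and \<open>c, f\<close> force the analogous
  ratio; the quartic equation says that the two ratios agree.\<close>

lemma realized_syntheme_iff:
  assumes lab: "{a, b, c, d, e, f} = (UNIV :: 6 set)"
    and comb: "\<And>k v. \<alpha> k v = p k * \<alpha> a v + q k * \<alpha> d v"
    and det: "\<And>k l. k \<noteq> l \<Longrightarrow> p k * q l - p l * q k \<noteq> 0"
    and ad: "p a = 1" "q a = 0" "p d = 0" "q d = 1"
  shows "realized (\<langle>a \<leftrightarrow> d\<rangle> * \<langle>b \<leftrightarrow> e\<rangle> * \<langle>c \<leftrightarrow> f\<rangle>) \<longleftrightarrow>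
    p b * p e * q c * q f = q b * q e * p c * p f" (is "realized ?\<sigma> \<longleftrightarrow> _")
proof
  note dist = labelling_distinct[OF lab]
  note \<sigma> = syntheme_apply[OF lab]
  have "a \<noteq> d" using dist by simp
  note point = ex_common_point[OF this]
  {
    assume "realized ?\<sigma>"
    then obtain M s where s: "\<forall>i. s i \<noteq> 0" and M: "\<forall>i v. \<alpha> i (M v) = s i * \<alpha> (?\<sigma> \<langle>$\<rangle> i) v"
      unfolding realized_def by blast
    have Ma: "\<alpha> a (M v) = s a * \<alpha> d v" and Md: "\<alpha> d (M v) = s d * \<alpha> a v" for v
      using M \<sigma> by simp_all
    have eq: "p k * (s a * \<alpha> d v) + q k * (s d * \<alpha> a v) =
        s k * (p (?\<sigma> \<langle>$\<rangle> k) * \<alpha> a v + q (?\<sigma> \<langle>$\<rangle> k) * \<alpha> d v)" for k v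
    proof -
      have "p k * (s a * \<alpha> d v) + q k * (s d * \<alpha> a v) = \<alpha> k (M v)"
        unfolding comb[of k "M v"] Ma Md ..
      also have "\<dots> = s k * \<alpha> (?\<sigma> \<langle>$\<rangle> k) v" using M by blast
      finally show ?thesis unfolding comb[of "?\<sigma> \<langle>$\<rangle> k" v] .
    qed
    \<comment> \<open>Evaluation on the basis dual to \<open>\<alpha> a, \<alpha> d\<close> compares
      coefficients.\<close>
    obtain v1 where v1: "\<alpha> a v1 = 1" "\<alpha> d v1 = 0" using point by blast
    obtain v2 where v2: "\<alpha> a v2 = 0" "\<alpha> d v2 = 1" using point by blast
    have e1: "q b * s d = s b * p e" using eq[of b v1] unfolding v1 \<sigma> by simp
    have e2: "p b * s a = s b * q e" using eq[of b v2] unfolding v2 \<sigma> by simp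
    have e3: "q c * s d = s c * p f" using eq[of c v1] unfolding v1 \<sigma> by simp
    have e4: "p c * s a = s c * q f" using eq[of c v2] unfolding v2 \<sigma> by simp
    have "(s a * s b * s c * s d) * (p b * p e * q c * q f) =
        (p b * s a) * (s b * p e) * (q c * s d) * (s c * q f)" by (simp add: mult_ac)
    also have "\<dots> = (s b * q e) * (q b * s d) * (s c * p f) * (p c * s a)"
      unfolding e1 e2 e3 e4 by (simp add: mult_ac)
    also have "\<dots> = (s a * s b * s c * s d) * (q b * q e * p c * p f)" by (simp add: mult_ac)
    finally show "p b * p e * q c * q f = q b * q e * p c * p f" using s by simp
  }
  {
    assume Q: "p b * p e * q c * q f = q b * q e * p c * p f"
    \<comment> \<open>With \<open>a\<close> and \<open>d\<close> as frame, both coordinates of any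
      other form are determinants up to sign.\<close>
    have nz: "p k \<noteq> 0" "q k \<noteq> 0" if "k \<noteq> a" "k \<noteq> d" for k
      using det[of k d] det[of a k] that ad by auto
    have nz: "p b \<noteq> 0" "q b \<noteq> 0" "p c \<noteq> 0" "q c \<noteq> 0" "p e \<noteq> 0" "q e \<noteq> 0" "p f \<noteq> 0" "q f \<noteq> 0"
      using nz dist by simp_all
    have "\<exists>w. \<alpha> a w = q b * q e * \<alpha> d v \<and> \<alpha> d w = p b * p e * \<alpha> a v" for v
      using point by blast
    then obtain M where M: "\<forall>v. \<alpha> a (M v) = q b * q e * \<alpha> d v \<and> \<alpha> d (M v) = p b * p e * \<alpha> a v"
      by metis
    \<comment> \<open>Taking \<open>s a\<close> and \<open>s d\<close> in the ratio forced by
      \<open>b, e\<close>, the other factors are read off from coefficients; those at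
      \<open>c\<close> and \<open>f\<close> come from the coefficient of \<open>\<alpha> d\<close>,
      and the quartic equation settles that of \<open>\<alpha> a\<close>.\<close>
    define s where "s k = (if k = a then q b * q e else if k = d then p b * p e
      else if k = b then p b * q b else if k = e then p e * q e
      else if k = c then p c * q b * q e / q f else p f * q b * q e / q c)" for k
    have s: "s a = q b * q e" "s d = p b * p e" "s b = p b * q b" "s e = p e * q e"
      "s c = p c * q b * q e / q f" "s f = p f * q b * q e / q c"
      using dist by (simp_all add: s_def)
    have k: "\<alpha> k (M v) = p k * (q b * q e * \<alpha> d v) + q k * (p b * p e * \<alpha> a v)" for k v
      using M comb[of k "M v"] by simp
    have "\<alpha> a (M v) = s a * \<alpha> d v" "\<alpha> d (M v) = s d * \<alpha> a v" for v
      using M s by simp_all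
    moreover have "\<alpha> b (M v) = s b * \<alpha> e v" "\<alpha> e (M v) = s e * \<alpha> b v" for v
      unfolding k[of b] k[of e] comb[of b v] comb[of e v] s by (simp_all add: algebra_simps)
    moreover have "\<alpha> c (M v) = s c * \<alpha> f v" for v
    proof -
      have "q f * (p c * (q b * q e * \<alpha> d v) + q c * (p b * p e * \<alpha> a v)) =
          p c * q b * q e * (p f * \<alpha> a v + q f * \<alpha> d v)"
        using Q by algebra
      then show ?thesis unfolding k[of c] comb[of f v] s using nz by (simp add: field_simps)
    qed
    moreover have "\<alpha> f (M v) = s f * \<alpha> c v" for v
    proof -
      have "q c * (p f * (q b * q e * \<alpha> d v) + q f * (p b * p e * \<alpha> a v)) =
          p f * q b * q e * (p c * \<alpha> a v + q c * \<alpha> d v)"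
        using Q by algebra
      then show ?thesis unfolding k[of f] comb[of c v] s using nz by (simp add: field_simps)
    qed
    ultimately have "\<forall>i. \<forall>v. \<alpha> i (M v) = s i * \<alpha> (?\<sigma> \<langle>$\<rangle> i) v"
      unfolding labelling_all[OF lab] \<sigma> by blast
    moreover have "\<forall>i. s i \<noteq> 0" unfolding labelling_all[OF lab] s using nz by simp
    ultimately show "realized ?\<sigma>" unfolding realized_def by blast
  }
qed

end

section \<open>Linear dependence of the four hyperplanes of a Pasch configuration\<close>

definition det_form :: "('i \<Rightarrow> 'a::field) \<Rightarrow> ('i \<Rightarrow> 'a) \<Rightarrow> 'i \<Rightarrow> 'i \<Rightarrow> 'i \<Rightarrow> 'a ^ 'i \<Rightarrow> 'a" where
  "det_form p q i j k x =
     (p j * q k - p k * q j) * x $ i - (p i * q k - p k * q i) * x $ j + (p i * q j - p j * q i) * x $ k"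

lemma linear_det_form: "Vector_Spaces.linear (*s) (*) (det_form p q i j k)"
  by (simp add: Vector_Spaces.linear_iff det_form_def algebra_simps
      vec.vector_space_axioms vector_space_over_itself.vector_space_axioms)

lemma subspace_kernel:
  fixes g :: "'a::field ^ 'n \<Rightarrow> 'a"
  assumes "Vector_Spaces.linear (*s) (*) g"
  shows "vec.subspace {x. g x = 0}"
proof -
  have lin: "g (x + y) = g x + g y" "g (c *s x) = c * g x" for x y c
    using assms by (simp_all add: Vector_Spaces.linear_iff)
  then show ?thesis using lin(2)[of 0 0] by (simp add: vec.subspace_def)
qed

text \<open>The quartic equation decides whether the fourth form vanishes on the common kernel of
  the first three: one test vector gives necessity, a polynomial identity sufficiency.\<close>

lemma det_form_pasch_dependent_iff:
  fixes p q :: "6 \<Rightarrow> 'a::field"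
  assumes dist: "distinct [a, b, c, d, e, f]"
    and det: "\<And>k l. k \<noteq> l \<Longrightarrow> p k * q l - p l * q k \<noteq> 0"
    and ad: "p a = 1" "q a = 0" "p d = 0" "q d = 1"
  shows "(\<forall>x. det_form p q a b c x = 0 \<longrightarrow> det_form p q a e f x = 0 \<longrightarrow> det_form p q b d f x = 0 \<longrightarrow>
      det_form p q c d e x = 0) \<longleftrightarrow>
    p b * p e * q c * q f = q b * q e * p c * p f" (is "?L \<longleftrightarrow> ?Q")
proof
  assume L: ?L
  \<comment> \<open>Up to scaling, the only common zero of the first three forms with vanishing
    entries at \<open>a\<close>, \<open>e\<close>, \<open>f\<close>. The fourth form takes there the
    difference of the two sides of the quartic equation.\<close>
  define x where "x = (\<chi> k. if k = b then q b * (p b * q f - p f * q b)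
    else if k = c then q c * (p b * q f - p f * q b) else if k = d then - p f * q b else 0)"
  have x: "x $ a = 0" "x $ b = q b * (p b * q f - p f * q b)"
    "x $ c = q c * (p b * q f - p f * q b)" "x $ d = - p f * q b" "x $ e = 0" "x $ f = 0"
    using dist by (auto simp: x_def)
  have "det_form p q a b c x = 0" "det_form p q a e f x = 0" "det_form p q b d f x = 0"
    unfolding det_form_def x ad by (simp_all add: algebra_simps)
  then have "det_form p q c d e x = 0" using L by blast
  then show ?Q unfolding det_form_def x ad by (simp add: algebra_simps)
next
  assume Q: ?Q
  have nz: "q b \<noteq> 0" "q f \<noteq> 0" "p b * q f - p f * q b \<noteq> 0"
    using det[of a b] det[of a f] det[of b f] dist ad by auto
  show ?L
  proof (intro allI impI)
    fix x assume F: "det_form p q a b c x = 0" "det_form p q a e f x = 0" "det_form p q b d f x = 0"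
    \<comment> \<open>Under the quartic equation this multiple of the fourth form is a combination
      of the first three, and its factor is nonzero by genericity.\<close>
    have "q b * q f * (p b * q f - p f * q b) * det_form p q c d e x = 0"
      using F Q unfolding det_form_def ad by algebra
    then show "det_form p q c d e x = 0" using nz by simp
  qed
qed

context generic_lines
begin

lemma codim_pasch_iff:
  assumes T: "corresponding \<sigma> T"
  shows "codim (\<Inter>L\<in>T. D_triple \<alpha> L) = 3 \<longleftrightarrow> realized \<sigma>"
proof -
  obtain a b c d e f where lab: "{a, b, c, d, e, f} = (UNIV :: 6 set)"
    and \<sigma>: "\<sigma> = \<langle>a \<leftrightarrow> d\<rangle> * \<langle>b \<leftrightarrow> e\<rangle> * \<langle>c \<leftrightarrow> f\<rangle>" and T: "T = pasch a b c d e f"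
    using T by (rule corresponding_cases)
  note dist = labelling_distinct[OF lab]
  have ad: "a \<noteq> d" using dist by simp
  obtain p q where comb: "\<And>k v. \<alpha> k v = p k * \<alpha> a v + q k * \<alpha> d v"
    and det: "\<And>k l. k \<noteq> l \<Longrightarrow> p k * q l - p l * q k \<noteq> 0"
    and pq: "p a = 1" "q a = 0" "p d = 0" "q d = 1"
    using ex_frame_coordinates[OF ad] by metis
  define K where "K i j k = {x. det_form p q i j k x = 0}" for i j k
  have K: "D_triple \<alpha> {i, j, k} = K i j k" if "i \<noteq> j" for i j k
    unfolding K_def det_form_def using D_triple_iff[OF comb ad det[OF that]] by blast
  have sub: "vec.subspace (K i j k)" for i j k
    unfolding K_def by (rule subspace_kernel[OF linear_det_form])
  note step = dim_Int_kernel[OF _ linear_det_form[of p q], folded K_def]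
  \<comment> \<open>The unit vectors at \<open>c\<close>, \<open>e\<close>, \<open>d\<close> show in
    turn that each hyperplane cuts the previous intersection properly, so the dimension falls to 5,
    4, 3. Codimension 3 then means that the fourth hyperplane cuts nothing more.\<close>
  have "det_form p q a b c (axis c 1) \<noteq> 0"
    using dist det[of a b] by (simp add: det_form_def axis_def)
  then have dim1: "vec.dim (K a b c) = 5"
    using step[of UNIV "axis c 1" a b c] by (simp add: card_cart_basis)
  have w2: "axis e 1 \<in> K a b c" "det_form p q a e f (axis e 1) \<noteq> 0"
    using dist det[of a f] by (simp_all add: K_def det_form_def axis_def)
  then have dim2: "vec.dim (K a b c \<inter> K a e f) = 4"
    using step[OF sub w2] dim1 by simp
  have w3: "axis d 1 \<in> K a b c \<inter> K a e f" "det_form p q b d f (axis d 1) \<noteq> 0"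
    using dist det[of b f] by (simp_all add: K_def det_form_def axis_def)
  then have dim3: "vec.dim (K a b c \<inter> K a e f \<inter> K b d f) = 3"
    using step[OF vec.subspace_inter[OF sub sub] w3] dim2 by simp
  have X: "(\<Inter>L\<in>T. D_triple \<alpha> L) = K a b c \<inter> K a e f \<inter> K b d f \<inter> K c d e"
    using K dist by (simp add: T pasch_def Int_assoc)
  have "codim (\<Inter>L\<in>T. D_triple \<alpha> L) = 3 \<longleftrightarrow> K a b c \<inter> K a e f \<inter> K b d f \<subseteq> K c d e"
  proof
    assume "K a b c \<inter> K a e f \<inter> K b d f \<subseteq> K c d e"
    then show "codim (\<Inter>L\<in>T. D_triple \<alpha> L) = 3"
      unfolding X codim_def by (simp add: Int_absorb2 dim3)
  next
    assume codim: "codim (\<Inter>L\<in>T. D_triple \<alpha> L) = 3"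
    show "K a b c \<inter> K a e f \<inter> K b d f \<subseteq> K c d e"
    proof (rule ccontr)
      assume "\<not> K a b c \<inter> K a e f \<inter> K b d f \<subseteq> K c d e"
      then obtain x where x: "x \<in> K a b c \<inter> K a e f \<inter> K b d f" "det_form p q c d e x \<noteq> 0"
        unfolding K_def by blast
      then have "vec.dim (K a b c \<inter> K a e f \<inter> K b d f \<inter> K c d e) + 1 = 3"
        using step[OF vec.subspace_inter[OF vec.subspace_inter[OF sub sub] sub] x] dim3 by simp
      then show False using codim unfolding X codim_def by simp
    qed
  qed
  also have "\<dots> \<longleftrightarrow> (\<forall>x. det_form p q a b c x = 0 \<longrightarrow> det_form p q a e f x = 0 \<longrightarrow>
      det_form p q b d f x = 0 \<longrightarrow> det_form p q c d e x = 0)"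
    unfolding K_def by blast
  also have "\<dots> \<longleftrightarrow> realized \<sigma>"
    unfolding \<sigma>
    by (rule trans[OF det_form_pasch_dependent_iff[OF dist(1) det pq]
        realized_syntheme_iff[OF lab comb det pq, symmetric]])
  finally show ?thesis .
qed

subsection \<open>Quadral points\<close>

text \<open>Each line outside \<open>S\<close> shares a triple of \<open>T\<close> with two lines of
  \<open>S\<close>, so it passes through their common point. All six lines are then concurrent,
  which has codimension at least 4.\<close>

lemma pasch_not_concurrent:
  assumes T: "corresponding \<sigma> T" and codim: "codim (\<Inter>L\<in>T. D_triple \<alpha> L) = 3" and S: "card S \<ge> 4"
  shows "\<not> (\<Inter>L\<in>T. D_triple \<alpha> L) \<subseteq> {x. concurrent x S}"
proof
  let ?X = "\<Inter>L\<in>T. D_triple \<alpha> L"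
  assume sub: "?X \<subseteq> {x. concurrent x S}"
  have "concurrent x UNIV" if x: "x \<in> ?X" for x
  proof -
    obtain v where v: "\<forall>i\<in>S. \<alpha> i v = x $ i" using sub x unfolding concurrent_def by blast
    have "\<alpha> u v = x $ u" for u
    proof (cases "u \<in> S")
      case False
      then obtain L where L: "L \<in> T" "u \<in> L" "L - {u} \<subseteq> S"
        using pasch_covers_outside[OF T S] by blast
      have "card (L - {u}) = 2" using card_pasch(2)[OF T L(1)] L(2) by simp
      then obtain i j where ij: "L - {u} = {i, j}" "i \<noteq> j" unfolding card_2_iff by blast
      have "concurrent x L" using x L(1) by (auto simp: D_triple_eq)
      then obtain w where w: "\<forall>k\<in>L. \<alpha> k w = x $ k" unfolding concurrent_def by blast
      have "i \<in> S" "j \<in> S" "i \<in> L" "j \<in> L" using ij L(3) by blast+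
      then have "v = w" using v w by (intro common_point_unique[OF ij(2)]) simp_all
      then show ?thesis using w L(2) by blast
    qed (use v in blast)
    then show ?thesis unfolding concurrent_def by blast
  qed
  then have "vec.dim ?X \<le> vec.dim {x. concurrent x UNIV}" by (intro vec.dim_subset) blast
  then show False using dim_concurrent_UNIV_le codim unfolding codim_def by linarith
qed

text \<open>A triple of \<open>T'\<close> outside \<open>T\<close> shares two lines with some triple
  of \<open>T\<close>; their union would give at least four concurrent lines on the whole
  intersection.\<close>

lemma pasch_intersection_inj:
  assumes T: "corresponding \<sigma> T" and T': "corresponding \<tau> T'"
    and eq: "(\<Inter>L\<in>T. D_triple \<alpha> L) = (\<Inter>L\<in>T'. D_triple \<alpha> L)"
    and codim: "codim (\<Inter>L\<in>T. D_triple \<alpha> L) = 3"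
  shows "T = T'"
proof -
  have "K \<in> T" if K: "K \<in> T'" for K
  proof (rule ccontr)
    assume "K \<notin> T"
    have K3: "card K = 3" by (rule card_pasch(2)[OF T' K])
    obtain L i j where L: "L \<in> T" and ij: "i \<noteq> j" "i \<in> K" "j \<in> K" "i \<in> L" "j \<in> L"
      using pasch_meets_triple[OF T K3] by blast
    have L3: "card L = 3" by (rule card_pasch(2)[OF T L])
    have "L \<noteq> K" using L \<open>K \<notin> T\<close> by blast
    then have "\<not> K \<subseteq> L" using card_subset_eq[of L K] L3 K3 by auto
    then have "L \<subset> L \<union> K" by blast
    then have "card L < card (L \<union> K)" by (intro psubset_card_mono) auto
    then have "card (L \<union> K) \<ge> 4" using L3 by simp
    moreover have "concurrent x (L \<union> K)" if x: "x \<in> (\<Inter>L\<in>T. D_triple \<alpha> L)" for x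
    proof -
      have "concurrent x L" using x L by (auto simp: D_triple_eq)
      moreover have "concurrent x K" using x K unfolding eq by (auto simp: D_triple_eq)
      ultimately show ?thesis using concurrent_Un ij by blast
    qed
    ultimately show False using pasch_not_concurrent[OF T codim] by blast
  qed
  then have "T' \<subseteq> T" by blast
  then show ?thesis using card_subset_eq[of T T'] card_pasch(1)[OF T] card_pasch(1)[OF T'] by simp
qed

text \<open>If two triples share two lines, their hyperplanes meet exactly in \<open>D_set\<close>
  of their union, which violates simplicity. So distinct triples share at most one line.\<close>

lemma simple_imp_pasch:
  assumes simple: "simple_intersection \<alpha> T" and card: "card T = 4"
  shows "\<exists>\<sigma>. corresponding \<sigma> T"
proof (rule ex_pasch[OF card])
  show card3: "card L = 3" if "L \<in> T" for L
    using simple that by (simp add: simple_intersection_def)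
  show False if L: "L \<in> T" "L' \<in> T" "L \<noteq> L'" and ij: "i \<noteq> j" "i \<in> L" "j \<in> L" "i \<in> L'" "j \<in> L'"
    for L L' i j
  proof -
    have "\<not> L' \<subseteq> L" using card_subset_eq[of L L'] L card3 by auto
    then have "L \<subset> L \<union> L'" by blast
    then have "card L < card (L \<union> L')" by (intro psubset_card_mono) auto
    then have S: "card (L \<union> L') > 3" using card3[OF L(1)] by simp
    have "(\<Inter>L\<in>{L, L'}. D_triple \<alpha> L) = {x. concurrent x (L \<union> L')}"
    proof (intro equalityI subsetI)
      fix x assume "x \<in> (\<Inter>L\<in>{L, L'}. D_triple \<alpha> L)"
      then show "x \<in> {x. concurrent x (L \<union> L')}"
        using concurrent_Un[OF _ _ ij] by (simp add: D_triple_eq)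
    next
      fix x assume "x \<in> {x. concurrent x (L \<union> L')}"
      then show "x \<in> (\<Inter>L\<in>{L, L'}. D_triple \<alpha> L)"
        using concurrent_mono[of x "L \<union> L'"] by (simp add: D_triple_eq)
    qed
    then have "(\<Inter>L\<in>{L, L'}. D_triple \<alpha> L) = D_set \<alpha> (L \<union> L')"
      using S by (simp add: D_set_eq)
    moreover have "{L, L'} \<subseteq> T" "card {L, L'} \<ge> 2" using L by simp_all
    ultimately show False using simple S unfolding simple_intersection_def by blast
  qed
qed

text \<open>A forbidden equality would make more than three lines concurrent on the whole
  intersection.\<close>

lemma pasch_imp_simple:
  assumes T: "corresponding \<sigma> T" and codim: "codim (\<Inter>L\<in>T. D_triple \<alpha> L) = 3"
  shows "simple_intersection \<alpha> T"
  unfolding simple_intersection_def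
proof (intro conjI ballI allI impI notI)
  show "card L = 3" if "L \<in> T" for L using card_pasch(2)[OF T that] .
  fix I S assume *: "I \<subseteq> T \<and> 2 \<le> card I \<and> 3 < card S" and eq: "(\<Inter>L\<in>I. D_triple \<alpha> L) = D_set \<alpha> S"
  have "(\<Inter>L\<in>T. D_triple \<alpha> L) \<subseteq> (\<Inter>L\<in>I. D_triple \<alpha> L)" using * by blast
  also have "\<dots> = {x. concurrent x S}" using * eq by (simp add: D_set_eq)
  finally show False using pasch_not_concurrent[OF T codim, of S] * by simp
qed

lemma quadral_points_eq:
  "quadral_points \<alpha> = {\<Inter>L\<in>T. D_triple \<alpha> L | T. \<exists>\<sigma>. corresponding \<sigma> T \<and> realized \<sigma>}"
proof -
  have "simple_intersection \<alpha> T \<and> card T = 4 \<and> codim (\<Inter>L\<in>T. D_triple \<alpha> L) = 3 \<longleftrightarrow>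
      (\<exists>\<sigma>. corresponding \<sigma> T \<and> realized \<sigma>)" for T
    using simple_imp_pasch pasch_imp_simple codim_pasch_iff card_pasch(1) by metis
  then show ?thesis unfolding quadral_points_def by simp
qed

end

subsection \<open>Partitions and their edges\<close>

lemma swap_eq_imp:
  assumes "\<langle>i \<leftrightarrow> j\<rangle> = \<langle>k \<leftrightarrow> l\<rangle>" "i \<noteq> j"
  shows "{i, j} = {k, l}"
proof -
  have "\<langle>k \<leftrightarrow> l\<rangle> \<langle>$\<rangle> i = j" using assms by (metis apply_swap_simp(1))
  then show ?thesis using assms(2) apply_swap_same[of i k l] by (cases "i = k"; cases "i = l") auto
qed

lemma edge_iff: "{i, j} \<in> block_edges V \<longleftrightarrow> i \<noteq> j \<and> (\<exists>B\<in>V. i \<in> B \<and> j \<in> B)"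
  by (auto simp: block_edges_def doubleton_eq_iff)

lemma partition_eqI:
  assumes V: "partition_on A V" and W: "partition_on A W"
    and rel: "\<And>x y. (\<exists>B\<in>V. x \<in> B \<and> y \<in> B) \<longleftrightarrow> (\<exists>B\<in>W. x \<in> B \<and> y \<in> B)"
  shows "V = W"
proof -
  have "V = A // {(x, y). \<exists>B\<in>V. x \<in> B \<and> y \<in> B}" using partition_on_eq_quotient[OF V] ..
  also have "\<dots> = A // {(x, y). \<exists>B\<in>W. x \<in> B \<and> y \<in> B}" by (simp only: rel)
  also have "\<dots> = W" by (rule partition_on_eq_quotient[OF W])
  finally show ?thesis .
qed

lemma card_edges:
  assumes V: "partition_on UNIV V"
  shows "card (block_edges V) = num_edges (partition_type V)"
proof -
  have fin: "finite V" by simp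
  have "block_edges V = (\<Union>B\<in>V. {e. e \<subseteq> B \<and> card e = 2})"
    unfolding block_edges_def card_2_iff by blast
  then have "card (block_edges V) = card (\<Union>B\<in>V. {e. e \<subseteq> B \<and> card e = 2})" by simp
  also have "\<dots> = (\<Sum>B\<in>V. card {e. e \<subseteq> B \<and> card e = 2})"
  proof (rule card_UN_disjoint[OF fin])
    show "\<forall>B\<in>V. \<forall>B'\<in>V. B \<noteq> B' \<longrightarrow>
      {e. e \<subseteq> B \<and> card e = 2} \<inter> {e. e \<subseteq> B' \<and> card e = 2} = {}"
      using partition_onD2[OF V] unfolding disjoint_def card_2_iff by blast
  qed simp
  also have "\<dots> = (\<Sum>B\<in>V. card B choose 2)" by (intro sum.cong refl n_subsets) simp
  \<comment> \<open>Blocks are grouped by size, matching the multiplicities in the type.\<close>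
  also have "\<dots> = (\<Sum>n\<in>card ` V. \<Sum>B\<in>{B\<in>V. card B = n}. card B choose 2)"
    by (rule sum.image_gen[OF fin])
  also have "\<dots> = (\<Sum>n\<in>card ` V. card {B\<in>V. card B = n} * (n choose 2))"
    by (intro sum.cong refl) simp
  also have "\<dots> = num_edges (partition_type V)"
    unfolding num_edges_def partition_type_def using fin
    by (intro sum.cong) (auto simp: count_image_mset vimage_def Int_def conj_commute)
  finally show ?thesis .
qed

text \<open>The automorphism is injective, and \<open>affected\<close> recovers an edge from its
  transposition.\<close>

lemma card_edge_perms: "card (block_edge_perms V) = card (block_edges V)"
proof -
  define Q where "Q = {\<langle>i \<leftrightarrow> j\<rangle> | i j. {i, j} \<in> block_edges V}"
  have "block_edge_perms V = outer_phi ` Q" unfolding block_edge_perms_def Q_def by blast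
  then have "card (block_edge_perms V) = card Q"
    using bij_outer_phi by (simp add: bij_is_inj card_image inj_on_subset[OF bij_is_inj])
  moreover have aff: "affected \<langle>i \<leftrightarrow> j\<rangle> = {i, j}" if "{i, j} \<in> block_edges V" for i j
    using that by (simp add: edge_iff affected_swap)
  have "inj_on affected Q"
  proof (rule inj_onI)
    fix x y assume "x \<in> Q" "y \<in> Q" and eq: "affected x = affected y"
    then obtain i j k l where "x = \<langle>i \<leftrightarrow> j\<rangle>" "{i, j} \<in> block_edges V" "y = \<langle>k \<leftrightarrow> l\<rangle>" "{k, l} \<in> block_edges V"
      unfolding Q_def by blast
    then show "x = y" using eq aff by (auto simp: doubleton_eq_iff swap_sym)
  qed
  then have "card Q = card (affected ` Q)" by (simp add: card_image)
  moreover have "affected ` Q = block_edges V"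
  proof (intro equalityI subsetI)
    fix e assume "e \<in> affected ` Q"
    then show "e \<in> block_edges V" using aff unfolding Q_def by force
  next
    fix e assume e: "e \<in> block_edges V"
    then obtain i j where ij: "e = {i, j}" unfolding block_edges_def by blast
    then have "\<langle>i \<leftrightarrow> j\<rangle> \<in> Q" using e unfolding Q_def by blast
    then show "e \<in> affected ` Q" using aff[of i j] e ij by (metis imageI)
  qed
  ultimately show ?thesis by simp
qed

section \<open>Existence and uniqueness of the partition, and the count\<close>

context generic_lines
begin

text \<open>An equality of sets of subspaces becomes a condition on each pair because a quadral
  point determines its 4-set, the 4-set its permutation, and the permutation its edge.\<close>

lemma quadral_eq_edges_iff:
  "quadral_points \<alpha> = edge_intersections \<alpha> V \<longleftrightarrow>
    (\<forall>i j. i \<noteq> j \<longrightarrow> ((\<exists>B\<in>V. i \<in> B \<and> j \<in> B) \<longleftrightarrow> realized (outer_phi \<langle>i \<leftrightarrow> j\<rangle>)))"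
proof -
  let ?X = "\<lambda>T. \<Inter>L\<in>T. D_triple \<alpha> L"
  have edges: "edge_intersections \<alpha> V = {?X T | T. \<exists>i j. i \<noteq> j \<and> (\<exists>B\<in>V. i \<in> B \<and> j \<in> B) \<and>
      corresponding (outer_phi \<langle>i \<leftrightarrow> j\<rangle>) T}"
  proof -
    have "(\<exists>\<sigma>\<in>block_edge_perms V. corresponding \<sigma> T) \<longleftrightarrow>
        (\<exists>i j. i \<noteq> j \<and> (\<exists>B\<in>V. i \<in> B \<and> j \<in> B) \<and> corresponding (outer_phi \<langle>i \<leftrightarrow> j\<rangle>) T)" for T
      unfolding block_edge_perms_def edge_iff by blast
    then show ?thesis unfolding edge_intersections_def by (simp only:)
  qed
  have quadral: "quadral_points \<alpha> = {?X T | T. \<exists>i j. i \<noteq> j \<and> realized (outer_phi \<langle>i \<leftrightarrow> j\<rangle>) \<and>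
      corresponding (outer_phi \<langle>i \<leftrightarrow> j\<rangle>) T}"
  proof -
    have "(\<exists>\<sigma>. corresponding \<sigma> T \<and> realized \<sigma>) \<longleftrightarrow> (\<exists>i j. i \<noteq> j \<and>
        realized (outer_phi \<langle>i \<leftrightarrow> j\<rangle>) \<and> corresponding (outer_phi \<langle>i \<leftrightarrow> j\<rangle>) T)" for T
    proof
      assume "\<exists>\<sigma>. corresponding \<sigma> T \<and> realized \<sigma>"
      then obtain \<sigma> where \<sigma>: "corresponding \<sigma> T" "realized \<sigma>" by (elim exE conjE)
      obtain i j where "i \<noteq> j" "\<sigma> = outer_phi \<langle>i \<leftrightarrow> j\<rangle>"
        using corresponding_ex_outer_phi[OF \<sigma>(1)] by (elim exE conjE)
      then show "\<exists>i j. i \<noteq> j \<and> realized (outer_phi \<langle>i \<leftrightarrow> j\<rangle>) \<and> corresponding (outer_phi \<langle>i \<leftrightarrow> j\<rangle>) T"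
        using \<sigma> by (intro exI[of _ i] exI[of _ j]) simp
    qed (elim exE conjE, intro exI conjI)
    then show ?thesis unfolding quadral_points_eq by (simp only:)
  qed
  show ?thesis
  proof
    assume eq: "quadral_points \<alpha> = edge_intersections \<alpha> V"
    show "\<forall>i j. i \<noteq> j \<longrightarrow> ((\<exists>B\<in>V. i \<in> B \<and> j \<in> B) \<longleftrightarrow> realized (outer_phi \<langle>i \<leftrightarrow> j\<rangle>))"
    proof (intro allI impI iffI)
      fix i j :: 6 assume ij: "i \<noteq> j"
      obtain T where T: "corresponding (outer_phi \<langle>i \<leftrightarrow> j\<rangle>) T"
        using ex_corresponding_outer_phi[OF ij] by blast
      {
        assume "\<exists>B\<in>V. i \<in> B \<and> j \<in> B"
        then have "?X T \<in> quadral_points \<alpha>" unfolding eq edges using ij T by blast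
        then obtain T' \<tau> where "?X T = ?X T'" "corresponding \<tau> T'" "realized \<tau>"
          unfolding quadral_points_eq by blast
        \<comment> \<open>The codimension depends only on the subspace, so the criterion for
          \<open>T'\<close> transfers to \<open>T\<close>.\<close>
        then have "codim (?X T) = 3" using codim_pasch_iff by metis
        then show "realized (outer_phi \<langle>i \<leftrightarrow> j\<rangle>)" using codim_pasch_iff[OF T] by blast
      next
        assume re: "realized (outer_phi \<langle>i \<leftrightarrow> j\<rangle>)"
        then have "?X T \<in> edge_intersections \<alpha> V" unfolding eq[symmetric] quadral using ij T by blast
        then obtain T' k l B where X: "?X T = ?X T'" and T': "corresponding (outer_phi \<langle>k \<leftrightarrow> l\<rangle>) T'"
          and B: "B \<in> V" "k \<in> B" "l \<in> B"
          unfolding edges by blast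
        have "codim (?X T) = 3" using re codim_pasch_iff[OF T] by blast
        then have "T = T'" using pasch_intersection_inj[OF T T' X] by blast
        then have "outer_phi \<langle>i \<leftrightarrow> j\<rangle> = outer_phi \<langle>k \<leftrightarrow> l\<rangle>"
          using corresponding_unique T T' by blast
        then have "\<langle>i \<leftrightarrow> j\<rangle> = \<langle>k \<leftrightarrow> l\<rangle>" using bij_outer_phi by (simp add: bij_is_inj inj_eq)
        then have "{i, j} = {k, l}" using ij by (rule swap_eq_imp)
        then show "\<exists>B\<in>V. i \<in> B \<and> j \<in> B" using B by (auto simp: doubleton_eq_iff)
      }
    qed
  next
    assume rel: "\<forall>i j. i \<noteq> j \<longrightarrow> ((\<exists>B\<in>V. i \<in> B \<and> j \<in> B) \<longleftrightarrow> realized (outer_phi \<langle>i \<leftrightarrow> j\<rangle>))"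
    then have "(i \<noteq> j \<and> (\<exists>B\<in>V. i \<in> B \<and> j \<in> B) \<and> corresponding (outer_phi \<langle>i \<leftrightarrow> j\<rangle>) T) =
        (i \<noteq> j \<and> realized (outer_phi \<langle>i \<leftrightarrow> j\<rangle>) \<and> corresponding (outer_phi \<langle>i \<leftrightarrow> j\<rangle>) T)" for i j T
      by (cases "i = j") simp_all
    then show "quadral_points \<alpha> = edge_intersections \<alpha> V" unfolding edges quadral by (simp only:)
  qed
qed

lemma ex_partition:
  "\<exists>V. partition_on UNIV V \<and> quadral_points \<alpha> = edge_intersections \<alpha> V"
proof -
  define r where "r = {(i, j). realized (outer_phi \<langle>i \<leftrightarrow> j\<rangle>)}"
  have "outer_phi 1 = 1"
    using outer_phi_mult[of 1 1] perm.right_cancel[of 1 "outer_phi 1" "outer_phi 1"] by simp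
  then have "realized (outer_phi \<langle>i \<leftrightarrow> i\<rangle>)" for i
    by (simp add: realized_one)
  moreover have "realized (outer_phi \<langle>i \<leftrightarrow> k\<rangle>)"
    if R: "realized (outer_phi \<langle>i \<leftrightarrow> j\<rangle>)" "realized (outer_phi \<langle>j \<leftrightarrow> k\<rangle>)" for i j k
  proof (cases "i = k \<or> j = k")
    \<comment> \<open>The conjugation formula below does not cover these cases; they follow from
      reflexivity or the first hypothesis.\<close>
    case True
    then show ?thesis using R calculation by metis
  next
    case False
    have "\<langle>i \<leftrightarrow> k\<rangle> * \<langle>i \<leftrightarrow> j\<rangle> = \<langle>i \<leftrightarrow> j\<rangle> * \<langle>j \<leftrightarrow> k\<rangle>"
    proof -
      have "\<langle>i \<leftrightarrow> j\<rangle> \<langle>$\<rangle> k = k" using False by (intro apply_swap_same) auto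
      then show ?thesis using perm_times_swap[of "\<langle>i \<leftrightarrow> j\<rangle>" j k] by simp
    qed
    then have "\<langle>i \<leftrightarrow> k\<rangle> = \<langle>i \<leftrightarrow> j\<rangle> * \<langle>j \<leftrightarrow> k\<rangle> * \<langle>i \<leftrightarrow> j\<rangle>"
      by (metis mult.assoc mult_1_right swap_self)
    then show ?thesis using R by (simp only: outer_phi_mult realized_mult)
  qed
  ultimately have r: "equiv UNIV r"
    by (intro equivI) (auto simp: r_def refl_on_def sym_def swap_sym intro: transI)
  have "(\<exists>B\<in>UNIV // r. i \<in> B \<and> j \<in> B) \<longleftrightarrow> realized (outer_phi \<langle>i \<leftrightarrow> j\<rangle>)" for i j
  proof
    assume "\<exists>B\<in>UNIV // r. i \<in> B \<and> j \<in> B"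
    then have "(i, j) \<in> r" using in_quotient_imp_in_rel[OF r] by blast
    then show "realized (outer_phi \<langle>i \<leftrightarrow> j\<rangle>)" by (simp add: r_def)
  next
    assume "realized (outer_phi \<langle>i \<leftrightarrow> j\<rangle>)"
    then have "(i, j) \<in> r" by (simp add: r_def)
    moreover have "(i, i) \<in> r" using r by (simp add: equiv_def refl_on_def)
    ultimately show "\<exists>B\<in>UNIV // r. i \<in> B \<and> j \<in> B" by (intro bexI[of _ "r `` {i}"]) (auto intro: quotientI)
  qed
  then have "quadral_points \<alpha> = edge_intersections \<alpha> (UNIV // r)" unfolding quadral_eq_edges_iff by blast
  then show ?thesis using partition_on_quotient[OF r] by blast
qed

lemma partition_unique:
  assumes V: "partition_on UNIV V" "quadral_points \<alpha> = edge_intersections \<alpha> V"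
    and W: "partition_on UNIV W" "quadral_points \<alpha> = edge_intersections \<alpha> W"
  shows "V = W"
proof (rule partition_eqI[OF V(1) W(1)])
  fix i j
  show "(\<exists>B\<in>V. i \<in> B \<and> j \<in> B) \<longleftrightarrow> (\<exists>B\<in>W. i \<in> B \<and> j \<in> B)"
  proof (cases "i = j")
    case True
    \<comment> \<open>The edges say nothing about a single vertex, but every vertex lies in some
      block.\<close>
    have "i \<in> \<Union>V" "i \<in> \<Union>W" using partition_onD1[OF V(1)] partition_onD1[OF W(1)] by auto
    then show ?thesis using True by blast
  next
    case False
    then show ?thesis
      using V(2)[unfolded quadral_eq_edges_iff, rule_format, OF False]
        W(2)[unfolded quadral_eq_edges_iff, rule_format, OF False] by simp
  qed
qed

text \<open>Every edge contributes two 4-sets, different edges contribute different ones, and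
  distinct 4-sets give distinct quadral points.\<close>

lemma card_quadral_points:
  assumes V: "partition_on UNIV V" and eq: "quadral_points \<alpha> = edge_intersections \<alpha> V"
  shows "card (quadral_points \<alpha>) = 2 * num_edges (partition_type V)"
proof -
  let ?X = "\<lambda>T. \<Inter>L\<in>T. D_triple \<alpha> L"
  let ?P = "block_edge_perms V"
  define N where "N = (\<Union>\<sigma>\<in>?P. {T. corresponding \<sigma> T})"
  have P: "realized \<sigma> \<and> (\<exists>T. corresponding \<sigma> T)" if "\<sigma> \<in> ?P" for \<sigma>
    using that eq ex_corresponding_outer_phi
    unfolding block_edge_perms_def edge_iff quadral_eq_edges_iff by blast
  have "finite {outer_phi \<langle>i \<leftrightarrow> j\<rangle> | i j. {i, j} \<in> block_edges V}"
    by (rule finite_subset[of _ "(\<lambda>(i, j). outer_phi \<langle>i \<leftrightarrow> j\<rangle>) ` UNIV"]) auto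
  then have fin: "finite ?P" by (simp only: block_edge_perms_def)
  have "quadral_points \<alpha> = ?X ` N" unfolding eq edge_intersections_def N_def by blast
  moreover have "inj_on ?X N"
  proof (rule inj_onI)
    fix T T' assume "T \<in> N" "T' \<in> N" and X: "?X T = ?X T'"
    then obtain \<sigma> \<tau> where \<sigma>: "\<sigma> \<in> ?P" and T: "corresponding \<sigma> T" and T': "corresponding \<tau> T'"
      unfolding N_def by blast
    have "codim (?X T) = 3" using codim_pasch_iff[OF T] P[OF \<sigma>] by blast
    then show "T = T'" by (rule pasch_intersection_inj[OF T T' X])
  qed
  ultimately have "card (quadral_points \<alpha>) = card N" by (simp only: card_image)
  also have "\<dots> = (\<Sum>\<sigma>\<in>?P. card {T. corresponding \<sigma> T})"
    unfolding N_def
  proof (rule card_UN_disjoint[OF fin])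
    show "\<forall>\<sigma>\<in>?P. \<forall>\<tau>\<in>?P. \<sigma> \<noteq> \<tau> \<longrightarrow> {T. corresponding \<sigma> T} \<inter> {T. corresponding \<tau> T} = {}"
      using corresponding_unique by blast
  qed simp
  also have "\<dots> = (\<Sum>\<sigma>\<in>?P. 2)"
    using P card_corresponding by (intro sum.cong refl) blast
  also have "\<dots> = 2 * num_edges (partition_type V)"
    by (simp add: card_edge_perms card_edges[OF V])
  finally show ?thesis .
qed

end

theorem theorem11:
  fixes \<alpha> :: "6 \<Rightarrow> 'a::field ^ 2 \<Rightarrow> 'a"
  assumes "generic_arrangement \<alpha>"
  shows "(\<exists>!V. partition_on UNIV V \<and> quadral_points \<alpha> = edge_intersections \<alpha> V) \<and>
         (\<forall>V. partition_on UNIV V \<and> quadral_points \<alpha> = edge_intersections \<alpha> V \<longrightarrow>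
            card (quadral_points \<alpha>) = 2 * num_edges (partition_type V))"
proof -
  interpret generic_lines \<alpha> by unfold_locales (rule assms)
  show ?thesis
  proof (intro conjI allI impI)
    show "\<exists>!V. partition_on UNIV V \<and> quadral_points \<alpha> = edge_intersections \<alpha> V"
      by (rule ex_ex1I[OF ex_partition]) (elim conjE, rule partition_unique)
    show "card (quadral_points \<alpha>) = 2 * num_edges (partition_type V)"
      if "partition_on UNIV V \<and> quadral_points \<alpha> = edge_intersections \<alpha> V" for V
      using that by (elim conjE) (rule card_quadral_points)
  qed
qed

end
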